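(* Let $0<V_-<V_+$. Let $\rho_+$ satisfy $\rho^*<\rho_+<1$ and let $\rho_-$ satisfy $0<\rho_-<\rho^*$ and $f_-(\rho_-)=f_+(\rho_+)$. Consider the initial value problem for $$Q'(x)=\begin{cases}\dfrac{Q(x)^2}{\ell\,\phi(Q(x))}\left[\phi(Q(x))-\phi(Q(x^\sharp))\right], & x^\sharp<0\ \text{or}\ x>0,\\[2mm] \dfrac{Q(x)^2}{\ell\,V_-\phi(Q(x))}\left[V_-\phi(Q(x))-V_+\phi(Q(x^\sharp))\right], & x<0<x^\sharp,\end{cases}\qquad x^\sharp=x+\frac{\ell}{Q(x)},\qquad ( * )$$ solved backward in $x$ on $x<0$, with initial data prescribed on $x\ge0$ as some horizontal shift (again denoted $W$) of the profile $W$ defined in the context, with $$\lim_{x\to\infty}W(x)=\rho_+,\qquad \rho_1^+\le W(0)\le\rho_2^- .$$ Then: (i) The initial value problem has a unique solution $Q(x)$ on $x<0$. (ii) This solution satisfies $\lim_{x\to-\infty}Q(x)=\rho_-$. (iii) Piecing together $Q(x)$ on $x<0$ and $Q(x)=W(x)$ on $x\ge0$, one obtains a solution of $( * )$ with boundary conditions $\lim_{x\to\infty}Q(x)=\rho_+$ and $\lim_{x\to-\infty}Q(x)=\rho_-$. (iv) Varying the value $Q(0)$, always satisfying $\rho_1^+\le Q(0)\le\rho_2^-$, one obtains infinitely many stationary wave profiles (solutions of $( * )$ on $\mathbb{R}$) with the boundary conditions in (iii).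
   Context: Standing setting: $\ell>0$ is the car length. $\phi:[0,1]\to[0,1]$ is twice differentiable with $\phi'\le-\hat c_0<0$, $\phi(0)=1$, $\phi(1)=0$, and is such that $f_\pm(\rho)=V_\pm\,\rho\,\phi(\rho)$ satisfy $f_\pm''\le -c_0<0$ for some constant $c_0>0$. $\rho^*\in(0,1)$ is the unique point with $f_-'(\rho^* )=f_+'(\rho^* )=0$. Put $\bar f=f_-(\rho_-)=f_+(\rho_+)$. Let $\rho_1^+<\rho^*$ be the value with $f_+(\rho_1^+)=\bar f$ and $\rho_2^->\rho^*$ the value with $f_-(\rho_2^-)=\bar f$; then $0<\rho_1^+<\rho_-<\rho^*<\rho_2^-<\rho_+$. $W$ denotes the solution on $\mathbb{R}$, unique up to horizontal shift, of $$W'(x)=\frac{W(x)^2}{\ell\,\phi(W(x))}\left[\phi(W(x))-\phi(W(x^\sharp))\right],\qquad x^\sharp=x+\frac{\ell}{W(x)},$$ with $\lim_{x\to-\infty}W(x)=\rho_1^+$ and $\lim_{x\to+\infty}W(x)=\rho_+$. It is known that $W$ exists and is monotone increasing. Solutions $Q$ are continuous functions on $\mathbb{R}$ with values in $(0,1)$, possibly with kinks; the derivative in the equation is understood as a left derivative (the equation is solved backward in $x$), and the equation is not imposed at points where $x=0$ or $x^\sharp=0$.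
   Formalization: Solutions are also required to have no interval on which x♯=0 identically; otherwise Q could follow Q(x)=−ℓ/x (for instance for all x left of the first point with x♯=0), where no equation is imposed, and uniqueness in (i) and the limit in (ii) would fail. *)

theory Defs
  imports "HOL-Analysis.Analysis"
begin

text \<open>First and second derivative on the closed interval \<open>[0,1]\<close>, one-sided at the end points.\<close>

definition has_derivs2 :: "(real \<Rightarrow> real) \<Rightarrow> (real \<Rightarrow> real) \<Rightarrow> (real \<Rightarrow> real) \<Rightarrow> bool" where
  "has_derivs2 g g1 g2 \<longleftrightarrow>
     (\<forall>x\<in>{0..1}. (g has_real_derivative g1 x) (at x within {0..1}) \<and>
                 (g1 has_real_derivative g2 x) (at x within {0..1}))"

definition flux :: "real \<Rightarrow> (real \<Rightarrow> real) \<Rightarrow> real \<Rightarrow> real" where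
  "flux V \<phi> \<rho> = V * \<rho> * \<phi> \<rho>"

text \<open>The position \<open>x\<^sup>\<sharp>\<close> of the leader of the car at \<open>x\<close>.\<close>

definition lead :: "real \<Rightarrow> (real \<Rightarrow> real) \<Rightarrow> real \<Rightarrow> real" where
  "lead l Q x = x + l / Q x"

definition profile ::
  "real \<Rightarrow> (real \<Rightarrow> real) \<Rightarrow> real \<Rightarrow> real \<Rightarrow> (real \<Rightarrow> real) \<Rightarrow> bool" where
  "profile l \<phi> a b W \<longleftrightarrow>
     (\<forall>x. 0 < W x \<and> W x < 1) \<and>
     (\<forall>x. (W has_real_derivative
            (W x)\<^sup>2 / (l * \<phi> (W x)) * (\<phi> (W x) - \<phi> (W (lead l W x)))) (at x)) \<and>
     (W \<longlongrightarrow> a) at_bot \<and> (W \<longlongrightarrow> b) at_top"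

text \<open>The stationary equation at \<open>x\<close>, with the left derivative; it says nothing when
  \<open>x = 0\<close> or \<open>x\<^sup>\<sharp> = 0\<close>.\<close>

definition stat_eq ::
  "real \<Rightarrow> (real \<Rightarrow> real) \<Rightarrow> real \<Rightarrow> real \<Rightarrow> (real \<Rightarrow> real) \<Rightarrow> real \<Rightarrow> bool" where
  "stat_eq l \<phi> Vm Vp Q x \<longleftrightarrow>
     (lead l Q x < 0 \<or> x > 0 \<longrightarrow>
        (Q has_real_derivative
          (Q x)\<^sup>2 / (l * \<phi> (Q x)) * (\<phi> (Q x) - \<phi> (Q (lead l Q x)))) (at_left x)) \<and>
     (x < 0 \<and> 0 < lead l Q x \<longrightarrow>
        (Q has_real_derivative
          (Q x)\<^sup>2 / (l * Vm * \<phi> (Q x)) * (Vm * \<phi> (Q x) - Vp * \<phi> (Q (lead l Q x)))) (at_left x))"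

text \<open>The points \<open>x\<close> with \<open>x\<^sup>\<sharp> = 0\<close> are exceptional: they may not fill an interval.
  Without this clause a function could follow the curve \<open>Q x = - l / x\<close>, on which
  \<open>x\<^sup>\<sharp> = 0\<close> identically, over an arbitrary interval without being subject to any equation,
  and the initial value problem would not have a unique solution.\<close>

definition solves_on ::
  "real \<Rightarrow> (real \<Rightarrow> real) \<Rightarrow> real \<Rightarrow> real \<Rightarrow> real set \<Rightarrow> (real \<Rightarrow> real) \<Rightarrow> bool" where
  "solves_on l \<phi> Vm Vp S Q \<longleftrightarrow>
     (\<forall>x\<in>S. 0 < Q x \<and> Q x < 1) \<and>
     interior {x \<in> S. lead l Q x = 0} = {} \<and>
     (\<forall>x\<in>S. stat_eq l \<phi> Vm Vp Q x)"

definition piece :: "(real \<Rightarrow> real) \<Rightarrow> (real \<Rightarrow> real) \<Rightarrow> real \<Rightarrow> real" where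
  "piece Q W = (\<lambda>x. if x < 0 then Q x else W x)"

text \<open>Only the values of \<open>Q\<close> on \<open>x < 0\<close> and those of the data \<open>W\<close> on \<open>x \<ge> 0\<close> matter.
  Continuity on \<open>{..0}\<close> includes that \<open>Q\<close> attains the initial value \<open>W 0\<close> at \<open>0\<close>.\<close>

definition ivp_solution ::
  "real \<Rightarrow> (real \<Rightarrow> real) \<Rightarrow> real \<Rightarrow> real \<Rightarrow> (real \<Rightarrow> real) \<Rightarrow> (real \<Rightarrow> real) \<Rightarrow> bool" where
  "ivp_solution l \<phi> Vm Vp W Q \<longleftrightarrow>
     continuous_on {..0} (piece Q W) \<and> solves_on l \<phi> Vm Vp {..<0} (piece Q W)"

definition stationary_wave ::
  "real \<Rightarrow> (real \<Rightarrow> real) \<Rightarrow> real \<Rightarrow> real \<Rightarrow> real \<Rightarrow> real \<Rightarrow> (real \<Rightarrow> real) \<Rightarrow> bool" where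
  "stationary_wave l \<phi> Vm Vp a b Q \<longleftrightarrow>
     continuous_on UNIV Q \<and> solves_on l \<phi> Vm Vp UNIV Q \<and>
     (Q \<longlongrightarrow> a) at_bot \<and> (Q \<longlongrightarrow> b) at_top"

definition shift :: "real \<Rightarrow> (real \<Rightarrow> real) \<Rightarrow> real \<Rightarrow> real" where
  "shift s W = (\<lambda>x. W (x + s))"

end

(* The problem is solved in Lagrangian form. Let z be the path of a car whose leader follows the same
   path with a fixed delay T = l / q, where q is the common flux. With the headway
   G t = z (t + T) - z t one has Q (z t) = l / G t, and the stationary equation becomes the advanced equation
   z' t = h (G t) for t < 0, with z prescribed for t >= 0 by the profile. It has a Lipschitz right
   hand side, so it is uniquely solvable by contraction. Conversely, along any solution of the equation the
   travel time from x to its leader is constant, equal to T for the data, so its path solves the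
   advanced equation and (i) follows. The fixed points of g |-> T * h g are l / rm and l / r2m; a
   first-crossing argument keeps G above l / r2m, and iterating the map as t decreases gives
   G --> l / rm, which is (ii). *)

theory Submission
  imports Defs
begin

text \<open>In the variable \<open>x\<close> the advance \<open>l / Q x\<close> depends on the
  unknown, and the right-hand side jumps where \<open>x\<close> or its leader crosses
  \<open>0\<close>. Along a path the advance in time is the fixed number \<open>T\<close>, and the
  only jump sits at \<open>t = 0\<close>. Travel time to the leader is constant because the leader
  position has as derivative the speed at the leader divided by the speed at \<open>x\<close>, which
  is exactly the ratio needed for cancellation; its value \<open>l / q\<close> is read off at
  infinity.

  The delicate point is the lower barrier \<open>l / r2m\<close>. Just above it
  \<open>g |-> T * h g\<close> moves upwards, so the iteration leaves it, but from the barrier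
  itself it makes no progress, and the data start exactly there when \<open>w 0 = r2m\<close>.
  Strictness just before time \<open>0\<close> then comes from a one-sided derivative of the
  headway, the crossing argument preserves it, and compactness turns it into a uniform gap from
  which the iteration can start.\<close>

section \<open>Monotonicity and growth from left derivatives\<close>

text \<open>Pick a level \<open>c\<close> between \<open>f b\<close> and \<open>f a\<close> outside
  the finite image of \<open>E\<close>. At the first point where \<open>f\<close> falls to
  \<open>c\<close>, a positive left derivative would force smaller values further left. Since only
  the image of \<open>E\<close> must be finite, \<open>E\<close> may contain intervals, such as a
  level set of the leader position.\<close>

lemma left_deriv_pos_imp_le:
  fixes f :: "real \<Rightarrow> real"
  assumes "a \<le> b" and cont: "continuous_on {a..b} f" and fin: "finite (f ` E)"
    and D: "\<And>x. a < x \<Longrightarrow> x \<le> b \<Longrightarrow> x \<notin> E \<Longrightarrow> \<exists>D>0. (f has_real_derivative D) (at_left x)"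
  shows "f a \<le> f b"
proof (rule ccontr)
  assume "\<not> f a \<le> f b"
  then have "infinite ({f b<..<f a} - f ` E)"
    using fin by (simp add: Diff_infinite_finite)
  then obtain c where c: "f b < c" "c < f a" "c \<notin> f ` E"
    by (metis DiffE ex_in_conv finite.emptyI greaterThanLessThan_iff)
  define S where "S = {x\<in>{a..b}. f x \<le> c}"
  have "closed S"
    unfolding S_def by (rule continuous_on_closed_Collect_le) (use cont in \<open>auto intro: continuous_intros\<close>)
  moreover have "b \<in> S" using c \<open>a \<le> b\<close> by (auto simp: S_def)
  moreover have bdd: "bdd_below S" by (auto simp: S_def intro!: bdd_belowI[of _ a])
  ultimately have y: "Inf S \<in> S" by (intro closed_contains_Inf) auto
  define y where "y = Inf S"
  have yS: "a \<le> y" "y \<le> b" "f y \<le> c" using y by (auto simp: S_def y_def)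
  have least: "y \<le> x" if "x \<in> S" for x using that bdd by (auto simp: y_def intro: cInf_lower)
  obtain x where x: "a \<le> x" "x \<le> y" "f x = c"
    using IVT2'[of f y c a] yS c continuous_on_subset[OF cont, of "{a..y}"] by auto
  then have "x = y" using least[of x] yS by (auto simp: S_def)
  then have fy: "f y = c" using x by simp
  have "a < y" using yS fy c by (cases "a = y") auto
  moreover have "y \<notin> E" using fy c by auto
  ultimately obtain D where "D > 0" "(f has_real_derivative D) (at_left y)" using D yS by blast
  then obtain d where d: "d > 0" "\<And>h. 0 < h \<Longrightarrow> h < d \<Longrightarrow> f (y - h) < f y"
    using has_real_derivative_pos_inc_left[of f D y "{..<y}"] by force
  define k where "k = min (d/2) ((y - a)/2)"
  have k: "0 < k" "k < d" "k \<le> y - a" using d \<open>a < y\<close> by (auto simp: k_def min_def field_simps)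
  have "y - k \<in> S" using k d(2)[of k] yS fy by (auto simp: S_def)
  then show False using least[of "y - k"] k by auto
qed

text \<open>The tilt \<open>(\<epsilon> - c) * x\<close> makes the left derivative strictly
  positive; \<open>\<epsilon>\<close> is scaled by the length of the interval so that the total
  error stays below \<open>e\<close>.\<close>

lemma left_deriv_ge_imp_growth:
  fixes f :: "real \<Rightarrow> real"
  assumes "a \<le> b" and cont: "continuous_on {a..b} f" and fin: "finite E"
    and D: "\<And>x. a < x \<Longrightarrow> x \<le> b \<Longrightarrow> x \<notin> E \<Longrightarrow> \<exists>D\<ge>c. (f has_real_derivative D) (at_left x)"
  shows "c * (b - a) \<le> f b - f a"
proof (rule field_le_epsilon)
  fix e :: real assume "0 < e"
  define \<epsilon> where "\<epsilon> = e / (b - a + 1)"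
  have e: "\<epsilon> > 0" "\<epsilon> * (b - a) \<le> e"
    using \<open>0 < e\<close> \<open>a \<le> b\<close> by (auto simp: \<epsilon>_def field_simps)
  have "f a + (\<epsilon> - c) * a \<le> f b + (\<epsilon> - c) * b"
  proof (rule left_deriv_pos_imp_le[OF \<open>a \<le> b\<close>, where E = E and f = "\<lambda>x. f x + (\<epsilon> - c) * x"])
    show "continuous_on {a..b} (\<lambda>x. f x + (\<epsilon> - c) * x)" by (intro continuous_intros cont)
    fix x assume "a < x" "x \<le> b" "x \<notin> E"
    then obtain D where D: "D \<ge> c" "(f has_real_derivative D) (at_left x)" using D by blast
    then have "((\<lambda>x. f x + (\<epsilon> - c) * x) has_real_derivative D + (\<epsilon> - c)) (at_left x)"
      by (auto intro!: derivative_eq_intros)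
    moreover have "D + (\<epsilon> - c) > 0" using D e by simp
    ultimately show "\<exists>D>0. ((\<lambda>x. f x + (\<epsilon> - c) * x) has_real_derivative D) (at_left x)" by blast
  qed (use fin in auto)
  then show "c * (b - a) \<le> f b - f a + e" using e by (simp add: algebra_simps)
qed

lemma left_deriv_zero_imp_eq:
  fixes f :: "real \<Rightarrow> real"
  assumes "a \<le> b" and cont: "continuous_on {a..b} f" and fin: "finite E"
    and D: "\<And>x. a < x \<Longrightarrow> x \<le> b \<Longrightarrow> x \<notin> E \<Longrightarrow> (f has_real_derivative 0) (at_left x)"
  shows "f a = f b"
proof -
  have "0 * (b - a) \<le> f b - f a"
    using D by (intro left_deriv_ge_imp_growth[OF \<open>a \<le> b\<close> cont fin]) auto
  moreover have "0 * (b - a) \<le> - f b - - f a"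
  proof (intro left_deriv_ge_imp_growth[OF \<open>a \<le> b\<close> _ fin])
    show "\<exists>D\<ge>0. ((\<lambda>x. - f x) has_real_derivative D) (at_left x)"
      if "a < x" "x \<le> b" "x \<notin> E" for x
      using DERIV_minus[OF D[OF that]] by auto
  qed (intro continuous_intros cont)
  ultimately show ?thesis by simp
qed

section \<open>Global inverses, scalar flows and iteration of eventual bounds\<close>

lemma expanding_imp_inverse:
  fixes f :: "real \<Rightarrow> real"
  assumes cont: "continuous_on UNIV f" and "c > 0"
    and lin: "\<And>x y. x \<le> y \<Longrightarrow> c * (y - x) \<le> f y - f x"
  obtains g where "\<And>x. g (f x) = x" "\<And>y. f (g y) = y" "\<And>y. isCont g y"
    "strict_mono f" "strict_mono g"
proof -
  have mono: "strict_mono f"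
  proof (rule strict_monoI)
    fix x y :: real assume "x < y"
    then have "0 < c * (y - x)" using \<open>c > 0\<close> by simp
    then show "f x < f y" using lin[of x y] \<open>x < y\<close> by linarith
  qed
  have surj: "\<exists>x. f x = y" for y
  proof -
    define X where "X = \<bar>y - f 0\<bar> / c"
    have X: "X \<ge> 0" "c * X = \<bar>y - f 0\<bar>" using \<open>c > 0\<close> by (auto simp: X_def)
    have "f (- X) \<le> y" "y \<le> f X" using lin[of "- X" 0] lin[of 0 X] X by auto
    then show ?thesis
      using IVT'[of f "- X" y X] X continuous_on_subset[OF cont, of "{- X..X}"] by auto
  qed
  define g where "g = inv f"
  have g1: "g (f x) = x" for x using strict_mono_imp_inj_on[OF mono] by (simp add: g_def)
  have g2: "f (g y) = y" for y unfolding g_def using surj by (metis surj_def surj_f_inv_f)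
  have "isCont g y" for y
    using isCont_inverse_function[of 1 "g y" g f] g1 g2 cont
    by (auto simp: continuous_on_eq_continuous_at)
  moreover have "strict_mono g" using mono g2 by (metis strict_mono_def strict_mono_less)
  ultimately show ?thesis using that g1 g2 mono by blast
qed

lemma antiderivative_exists:
  fixes f :: "real \<Rightarrow> real"
  assumes "continuous_on UNIV f"
  obtains F where "F 0 = 0" "\<And>x. (F has_real_derivative f x) (at x)"
proof -
  have "\<exists>F. \<forall>x::real. -\<infinity> < x \<longrightarrow> x < \<infinity> \<longrightarrow> (F has_vector_derivative f x) (at x)"
    using assms by (intro einterval_antiderivative) (auto simp: continuous_on_eq_continuous_at)
  then obtain F where "\<And>x. (F has_real_derivative f x) (at x)"
    by (auto simp: has_real_derivative_iff_has_vector_derivative)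
  then have "((\<lambda>x. F x - F 0) has_real_derivative f x) (at x)" for x
    by (auto intro!: derivative_eq_intros)
  then show ?thesis using that[of "\<lambda>x. F x - F 0"] by simp
qed

text \<open>Separation of variables: \<open>\<tau>\<close> is an antiderivative of
  \<open>1 / v\<close> and \<open>z\<close> its inverse, so continuity of \<open>v\<close> suffices.
  The upper bound on \<open>v\<close> makes \<open>\<tau>\<close> expanding, hence onto, and the
  flow exists for all time.\<close>

lemma flow_exists:
  fixes v :: "real \<Rightarrow> real"
  assumes cont: "continuous_on UNIV v" and v: "\<And>x. 0 < v x" "\<And>x. v x \<le> K"
  obtains \<tau> z where "\<tau> 0 = 0" "\<And>x. (\<tau> has_real_derivative 1 / v x) (at x)"
    "\<And>x. z (\<tau> x) = x" "\<And>t. \<tau> (z t) = t" "\<And>t. (z has_real_derivative v (z t)) (at t)"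
    "strict_mono \<tau>" "strict_mono z"
proof -
  have K: "K > 0" using v[of 0] by linarith
  obtain \<tau> where t0: "\<tau> 0 = 0" and D: "\<And>x. (\<tau> has_real_derivative 1 / v x) (at x)"
  proof (rule antiderivative_exists[of "\<lambda>x. 1 / v x"])
    have "v x \<noteq> 0" for x using v(1)[of x] by simp
    then show "continuous_on UNIV (\<lambda>x. 1 / v x)" by (intro continuous_intros cont) auto
  qed blast
  have ct: "isCont \<tau> x" for x using D DERIV_isCont by blast
  have lin: "1 / K * (y - x) \<le> \<tau> y - \<tau> x" if "x \<le> y" for x y
  proof (rule left_deriv_ge_imp_growth[OF that, of _ "{}"])
    show "\<exists>D\<ge>1 / K. (\<tau> has_real_derivative D) (at_left s)" for s
      using DERIV_subset[OF D[of s]] v[of s] K by (intro exI[of _ "1 / v s"]) (auto simp: frac_le)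
  qed (use ct in \<open>auto intro!: continuous_at_imp_continuous_on\<close>)
  obtain z where z: "\<And>x. z (\<tau> x) = x" "\<And>t. \<tau> (z t) = t" "\<And>t. isCont z t" "strict_mono \<tau>" "strict_mono z"
  proof (rule expanding_imp_inverse[of \<tau> "1 / K"])
    show "continuous_on UNIV \<tau>" using ct by (auto intro!: continuous_at_imp_continuous_on)
  qed (use lin K in auto)
  have "(z has_real_derivative v (z t)) (at t)" for t
    using DERIV_inverse_function[of \<tau> "1 / v (z t)" z t "t - 1" "t + 1"] D v(1)[of "z t"] z(2,3)
    by auto
  then show ?thesis using that[of \<tau> z] D z t0 by simp
qed

text \<open>The supremum of all eventual lower bounds cannot lie below \<open>p\<close>: there
  \<open>N\<close> moves it strictly up, and by continuity \<open>N\<close> also lifts some slightly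
  smaller, genuine eventual bound beyond the supremum. The bound \<open>B\<close> keeps the supremum
  finite.\<close>

lemma eventually_ge_by_iteration:
  fixes G N :: "real \<Rightarrow> real"
  assumes bd: "\<forall>\<^sub>F t in at_bot. a \<le> G t" "\<forall>\<^sub>F t in at_bot. G t \<le> B"
    and cont: "\<And>b. isCont N b"
    and up: "\<And>b. a \<le> b \<Longrightarrow> b < p \<Longrightarrow> b < N b"
    and step: "\<And>b. \<forall>\<^sub>F t in at_bot. b \<le> G t \<Longrightarrow> \<forall>\<^sub>F t in at_bot. N b \<le> G t"
    and "q < p"
  shows "\<forall>\<^sub>F t in at_bot. q \<le> G t"
proof -
  define S where "S = {b. \<forall>\<^sub>F t in at_bot. b \<le> G t}"
  have SB: "b \<le> B" if "b \<in> S" for b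
  proof -
    have "\<forall>\<^sub>F t in at_bot. b \<le> G t \<and> G t \<le> B" using that bd by (auto simp: S_def eventually_conj_iff)
    then have "\<exists>t. b \<le> G t \<and> G t \<le> B" using eventually_happens by fastforce
    then show ?thesis by auto
  qed
  have bdd: "bdd_above S" using SB by (rule bdd_aboveI)
  have aS: "a \<in> S" using bd by (simp add: S_def)
  have "p \<le> Sup S"
  proof (rule ccontr)
    assume "\<not> p \<le> Sup S"
    then have "Sup S < N (Sup S)" using up[of "Sup S"] cSup_upper[OF aS bdd] by auto
    then have "\<forall>\<^sub>F b in at_left (Sup S). Sup S < N b"
      using cont[of "Sup S"] by (auto simp: isCont_def filterlim_at_split order_tendstoD)
    then obtain b0 where b0: "b0 < Sup S" "\<And>b. b0 < b \<Longrightarrow> b < Sup S \<Longrightarrow> Sup S < N b"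
      by (auto simp: eventually_at_left_field)
    obtain b where b: "b \<in> S" "(b0 + Sup S) / 2 < b"
      using less_cSupD[of S "(b0 + Sup S) / 2"] aS b0 by auto
    have "\<forall>\<^sub>F t in at_bot. (b0 + Sup S) / 2 \<le> G t"
      using b(1) unfolding S_def mem_Collect_eq by (rule eventually_mono) (use b(2) in \<open>auto simp: S_def\<close>)
    then have "N ((b0 + Sup S) / 2) \<in> S" using step by (simp add: S_def)
    moreover have "Sup S < N ((b0 + Sup S) / 2)" using b0 by (intro b0(2)) auto
    ultimately show False using cSup_upper[OF _ bdd] by fastforce
  qed
  then obtain b where "b \<in> S" "q < b" using less_cSupD[of S q] aS \<open>q < p\<close> by auto
  then show ?thesis by (auto simp: S_def elim!: eventually_mono)
qed

section \<open>The advanced equation with bounded Lipschitz right-hand side\<close>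

text \<open>Integration backward from \<open>0\<close> gains the factor \<open>1 / \<mu>\<close> in
  the weight \<open>exp (- \<mu> * t)\<close>, so a large \<open>\<mu>\<close> yields a contraction
  on the whole half-line at once. The sign \<open>\<sigma>\<close> runs the same barrier comparison
  for \<open>d\<close> and \<open>- d\<close>.\<close>

lemma weighted_bound:
  fixes d :: "real \<Rightarrow> real"
  assumes cont: "continuous_on {..0} d" and "d 0 = 0" and \<mu>: "\<mu> > 0" and "K \<ge> 0"
    and D: "\<And>t. t < 0 \<Longrightarrow> \<exists>D. (d has_real_derivative D) (at t) \<and> \<bar>D\<bar> \<le> K * exp (- \<mu> * t)"
    and "t \<le> 0"
  shows "\<bar>d t\<bar> \<le> K / \<mu> * exp (- \<mu> * t)"
proof -
  have *: "\<sigma> * d t \<le> K / \<mu> * exp (- \<mu> * t)" if \<sigma>: "\<bar>\<sigma>\<bar> = 1" for \<sigma>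
  proof -
    define F where "F s = \<sigma> * d s - K / \<mu> * exp (- \<mu> * s)" for s
    have "F t \<le> F 0"
    proof (rule DERIV_nonneg_imp_increasing_open[OF \<open>t \<le> 0\<close>])
      fix s assume s: "t < s" "s < 0"
      then obtain D where D: "(d has_real_derivative D) (at s)" "\<bar>D\<bar> \<le> K * exp (- \<mu> * s)"
        using D by blast
      have "(F has_real_derivative \<sigma> * D + K * exp (- \<mu> * s)) (at s)"
        unfolding F_def using \<mu> by (auto intro!: derivative_eq_intros D(1))
      moreover have "\<bar>\<sigma> * D\<bar> \<le> K * exp (- \<mu> * s)" using D \<sigma> by (simp add: abs_mult)
      ultimately show "\<exists>y. (F has_real_derivative y) (at s) \<and> 0 \<le> y"
        by (auto intro!: exI[of _ "\<sigma> * D + K * exp (- \<mu> * s)"])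
    next
      show "continuous_on {t..0} F" unfolding F_def
        by (intro continuous_intros continuous_on_subset[OF cont]) auto
    qed
    then have "\<sigma> * d t \<le> K / \<mu> * exp (- \<mu> * t) - K / \<mu>" using \<open>d 0 = 0\<close> by (simp add: F_def)
    moreover have "K / \<mu> \<ge> 0" using \<mu> \<open>K \<ge> 0\<close> by simp
    ultimately show ?thesis by linarith
  qed
  show ?thesis using *[of 1] *[of "-1"] by auto
qed

text \<open>Each application of \<open>weighted_bound\<close> halves the bound on the difference
  \<open>d\<close>: the headways differ by two copies of \<open>d\<close>, and
  \<open>\<mu> = 4 * L\<close>. The advanced value \<open>d (s + T)\<close> does no harm, because
  the weight decreases in time and \<open>d\<close> vanishes at nonnegative times.\<close>

lemma advanced_equation_unique:
  fixes h :: "real \<Rightarrow> real"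
  assumes "T > 0" "L > 0" and lip: "\<And>a b. \<bar>h a - h b\<bar> \<le> L * \<bar>a - b\<bar>" and M: "\<And>a. \<bar>h a\<bar> \<le> M"
    and y: "continuous_on UNIV y" "\<And>t. t < 0 \<Longrightarrow> (y has_real_derivative h (y (t + T) - y t)) (at t)"
    and z: "continuous_on UNIV z" "\<And>t. t < 0 \<Longrightarrow> (z has_real_derivative h (z (t + T) - z t)) (at t)"
    and eq: "\<And>t. 0 \<le> t \<Longrightarrow> y t = z t"
  shows "y t = z t"
proof (cases "0 \<le> t")
  case False
  define d where "d t = y t - z t" for t
  define \<mu> where "\<mu> = 4 * L"
  have \<mu>: "\<mu> > 0" using \<open>L > 0\<close> by (simp add: \<mu>_def)
  have cd: "continuous_on {..0} d" unfolding d_def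
    by (intro continuous_intros continuous_on_subset[OF y(1)] continuous_on_subset[OF z(1)]) auto
  have d0: "d t = 0" if "0 \<le> t" for t using eq that by (simp add: d_def)
  have Dd: "(d has_real_derivative h (y (t + T) - y t) - h (z (t + T) - z t)) (at t)" if "t < 0" for t
    unfolding d_def by (intro DERIV_diff y z that)
  have M0: "M \<ge> 0" using M[of 0] by linarith
  have bound: "\<bar>d t\<bar> \<le> (2 * M / \<mu>) / 2 ^ n * exp (- \<mu> * t)" if "t \<le> 0" for n t
    using that
  proof (induction n arbitrary: t)
    case 0
    have "\<bar>d t\<bar> \<le> 2 * M / \<mu> * exp (- \<mu> * t)"
    proof (rule weighted_bound[OF cd _ \<mu> _ _ 0])
      fix s :: real assume s: "s < 0"
      have "\<bar>h (y (s + T) - y s) - h (z (s + T) - z s)\<bar> \<le> 2 * M * 1"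
        using M[of "y (s + T) - y s"] M[of "z (s + T) - z s"] by auto
      also have "\<dots> \<le> 2 * M * exp (- \<mu> * s)" using s \<mu> M0 by (intro mult_left_mono) (auto simp: mult_le_0_iff)
      finally show "\<exists>D. (d has_real_derivative D) (at s) \<and> \<bar>D\<bar> \<le> 2 * M * exp (- \<mu> * s)"
        using Dd[OF s] by blast
    qed (use M0 d0 in auto)
    then show ?case by simp
  next
    case (Suc n)
    define C where "C = (2 * M / \<mu>) / 2 ^ n"
    have C: "C \<ge> 0" using M0 \<mu> by (simp add: C_def)
    have IH: "\<bar>d s\<bar> \<le> C * exp (- \<mu> * s)" if "s \<le> 0" for s using Suc.IH that by (simp add: C_def)
    have "\<bar>d t\<bar> \<le> (2 * L * C) / \<mu> * exp (- \<mu> * t)"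
    proof (rule weighted_bound[OF cd _ \<mu> _ _ \<open>t \<le> 0\<close>])
      fix s :: real assume s: "s < 0"
      have "\<bar>d (s + T)\<bar> \<le> C * exp (- \<mu> * s)"
      proof (cases "s + T \<le> 0")
        case True
        have "\<bar>d (s + T)\<bar> \<le> C * exp (- \<mu> * (s + T))" by (rule IH[OF True])
        also have "\<dots> \<le> C * exp (- \<mu> * s)"
          using C \<mu> \<open>T > 0\<close> by (intro mult_left_mono) (auto simp: algebra_simps)
        finally show ?thesis .
      qed (use d0 C in simp)
      moreover have "\<bar>d s\<bar> \<le> C * exp (- \<mu> * s)" using IH s by simp
      moreover have "\<bar>h (y (s + T) - y s) - h (z (s + T) - z s)\<bar> \<le> L * \<bar>d (s + T) - d s\<bar>"
        using lip[of "y (s + T) - y s" "z (s + T) - z s"] by (simp add: d_def algebra_simps)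
      moreover have "L * \<bar>d (s + T) - d s\<bar> \<le> L * (2 * (C * exp (- \<mu> * s)))"
        using calculation \<open>L > 0\<close> by (intro mult_left_mono) auto
      ultimately have "\<bar>h (y (s + T) - y s) - h (z (s + T) - z s)\<bar> \<le> 2 * L * C * exp (- \<mu> * s)"
        by (simp add: algebra_simps)
      then show "\<exists>D. (d has_real_derivative D) (at s) \<and> \<bar>D\<bar> \<le> 2 * L * C * exp (- \<mu> * s)"
        using Dd[OF s] by blast
    qed (use C d0 \<open>L > 0\<close> in auto)
    then show ?case using \<open>L > 0\<close> by (simp add: C_def \<mu>_def field_simps)
  qed
  have "(\<lambda>n. (2 * M / \<mu> * exp (- \<mu> * t)) * (1/2) ^ n) \<longlonglongrightarrow> (2 * M / \<mu> * exp (- \<mu> * t)) * 0"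
    by (intro tendsto_intros LIMSEQ_power_zero) auto
  then have "\<bar>d t\<bar> \<le> 0"
    using bound[of t] False by (intro LIMSEQ_le_const[where X = "\<lambda>n. (2 * M / \<mu> * exp (- \<mu> * t)) * (1/2) ^ n"])
      (auto simp: field_simps power_divide)
  then show ?thesis by (simp add: d_def)
qed (use eq in auto)

text \<open>The derivative at \<open>0\<close> is a separate, one-sided conclusion, since
  \<open>z\<close> may have a kink there. It decides the borderline case in which the headway starts
  on the barrier.\<close>

lemma advanced_equation_exists:
  fixes h u :: "real \<Rightarrow> real"
  assumes "T > 0" "L > 0" and lip: "\<And>a b. \<bar>h a - h b\<bar> \<le> L * \<bar>a - b\<bar>" and M: "\<And>a. \<bar>h a\<bar> \<le> M"
    and u: "continuous_on UNIV u" "u 0 = 0"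
  obtains z where "continuous_on UNIV z" "\<And>t. 0 \<le> t \<Longrightarrow> z t = u t"
    "\<And>t. t < 0 \<Longrightarrow> (z has_real_derivative h (z (t + T) - z t)) (at t)"
    "(z has_real_derivative h (z T - z 0)) (at_left 0)"
proof -
  \<comment> \<open>Replacing \<open>d\<close> by \<open>e\<close> changes \<open>Z d\<close> by up
    to twice the weighted distance, because of the extra term \<open>d 0\<close>, and the headway by
    up to four times; \<open>8 * L\<close> then leaves the contraction factor
    \<open>1/2\<close>.\<close>
  define \<mu> where "\<mu> = 8 * L"
  have \<mu>: "\<mu> > 0" using \<open>L > 0\<close> by (simp add: \<mu>_def)
  have M0: "M \<ge> 0" using M[of 0] by linarith
  have ch: "continuous_on UNIV h"
  proof (rule lipschitz_on_continuous_on)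
    show "L-lipschitz_on UNIV h"
      using lip \<open>L > 0\<close> by (intro lipschitz_onI) (auto simp: dist_real_def)
  qed
  text \<open>In the weighted unknown \<open>d t = exp (\<mu> t) z t\<close> the integrated equation is a contraction
    on bounded continuous functions. The term \<open>d 0\<close> makes \<open>Z d\<close> continuous at \<open>0\<close>;
    it vanishes for the fixed point.\<close>
  define Z where "Z d t = u (max t 0) + (exp (- \<mu> * min t 0) * apply_bcontfun d (min t 0) - apply_bcontfun d 0)"
    for d :: "real \<Rightarrow>\<^sub>C real" and t
  have cZ: "continuous_on UNIV (Z d)" for d
    unfolding Z_def
    by (intro continuous_intros continuous_on_compose2[OF u(1)]
        continuous_on_compose2[OF continuous_on_apply_bcontfun[of UNIV]]) auto
  have ck: "continuous_on UNIV (\<lambda>s. h (Z d (s + T) - Z d s))" for d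
    by (intro continuous_on_compose2[OF ch] continuous_intros continuous_on_compose2[OF cZ]) auto
  have "\<exists>F. F 0 = 0 \<and> (\<forall>x. (F has_real_derivative h (Z d (x + T) - Z d x)) (at x))" for d
    using antiderivative_exists[OF ck] by metis
  then obtain J where J0: "\<And>d. J d 0 = 0"
    and J: "\<And>d x. (J d has_real_derivative h (Z d (x + T) - Z d x)) (at x)" by metis
  have cJ: "continuous_on S (J d)" for d S
    using J DERIV_isCont by (blast intro: continuous_at_imp_continuous_on)
  have Jb: "\<bar>J d t\<bar> \<le> M / \<mu> * exp (- \<mu> * t)" if "t \<le> 0" for d t
  proof (rule weighted_bound[OF cJ J0 \<mu> M0 _ that])
    fix s :: real assume "s < 0"
    have "\<bar>h (Z d (s + T) - Z d s)\<bar> \<le> M * 1" using M by simp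
    also have "\<dots> \<le> M * exp (- \<mu> * s)"
      using \<open>s < 0\<close> \<mu> M0 by (intro mult_left_mono) (auto simp: mult_le_0_iff)
    finally show "\<exists>D. (J d has_real_derivative D) (at s) \<and> \<bar>D\<bar> \<le> M * exp (- \<mu> * s)" using J by blast
  qed
  \<comment> \<open>The truncation \<open>min t 0\<close> continues the weighted integral by its
    value \<open>0\<close> at \<open>t = 0\<close>, which makes it a bounded continuous function on
    the whole line.\<close>
  define \<Phi> where "\<Phi> d = Bcontfun (\<lambda>t. exp (\<mu> * min t 0) * J d (min t 0))" for d
  have \<Phi>: "apply_bcontfun (\<Phi> d) t = exp (\<mu> * min t 0) * J d (min t 0)" for d t
  proof -
    have "(\<lambda>t. exp (\<mu> * min t 0) * J d (min t 0)) \<in> bcontfun"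
    proof (rule bcontfun_normI)
      show "continuous_on UNIV (\<lambda>t. exp (\<mu> * min t 0) * J d (min t 0))"
        by (intro continuous_intros continuous_on_compose2[OF cJ[of UNIV]]) auto
      show "norm (exp (\<mu> * min t 0) * J d (min t 0)) \<le> M / \<mu>" for t
      proof -
        have "exp (\<mu> * min t 0) * \<bar>J d (min t 0)\<bar>
            \<le> exp (\<mu> * min t 0) * (M / \<mu> * exp (- \<mu> * min t 0))"
          by (intro mult_left_mono Jb) auto
        also have "\<dots> = M / \<mu>" by (simp add: exp_minus)
        finally show ?thesis by (simp add: abs_mult)
      qed
    qed
    then show ?thesis by (simp add: \<Phi>_def Bcontfun_inverse)
  qed
  have Zlip: "\<bar>Z d s - Z e s\<bar> \<le> 2 * dist d e * exp (- \<mu> * r)" if "r \<le> 0" "r \<le> s" for d e r s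
  proof -
    define m where "m = min s 0"
    have m: "r \<le> m" "m \<le> 0" using that by (auto simp: m_def)
    have D: "\<bar>apply_bcontfun d x - apply_bcontfun e x\<bar> \<le> dist d e" for x
      using dist_bounded[of d x e] by (simp add: dist_real_def)
    have "Z d s - Z e s = exp (- \<mu> * m) * (apply_bcontfun d m - apply_bcontfun e m)
        - (apply_bcontfun d 0 - apply_bcontfun e 0)"
      by (simp add: Z_def m_def algebra_simps)
    also have "\<bar>\<dots>\<bar> \<le> exp (- \<mu> * m) * dist d e + 1 * dist d e"
    proof -
      have "\<bar>exp (- \<mu> * m) * (apply_bcontfun d m - apply_bcontfun e m)\<bar> \<le> exp (- \<mu> * m) * dist d e"
        using D[of m] by (simp add: abs_mult)
      then show ?thesis using D[of 0] by linarith
    qed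
    also have "\<dots> \<le> exp (- \<mu> * r) * dist d e + exp (- \<mu> * r) * dist d e"
      using m \<mu> that by (intro add_mono mult_right_mono) (auto simp: mult_le_0_iff)
    finally show ?thesis by (simp add: algebra_simps)
  qed
  have "\<exists>!d. \<Phi> d = d"
  proof (rule banach_fix_type[of "1/2"]; (intro allI)?)
    fix d e
    show "dist (\<Phi> d) (\<Phi> e) \<le> 1 / 2 * dist d e"
    proof (rule dist_bound)
      fix t :: real
      define m where "m = min t 0"
      have "m \<le> 0" by (simp add: m_def)
      have "\<bar>J d m - J e m\<bar> \<le> (4 * L * dist d e) / \<mu> * exp (- \<mu> * m)"
      proof (rule weighted_bound[where d = "\<lambda>m. J d m - J e m", OF _ _ \<mu> _ _ \<open>m \<le> 0\<close>])
        show "continuous_on {..0} (\<lambda>m. J d m - J e m)" by (intro continuous_intros cJ)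
        fix s :: real assume s: "s < 0"
        have "\<bar>h (Z d (s + T) - Z d s) - h (Z e (s + T) - Z e s)\<bar>
            \<le> L * \<bar>(Z d (s + T) - Z e (s + T)) - (Z d s - Z e s)\<bar>"
          using lip[of "Z d (s + T) - Z d s" "Z e (s + T) - Z e s"] by (simp add: algebra_simps)
        also have "\<dots> \<le> L * (2 * dist d e * exp (- \<mu> * s) + 2 * dist d e * exp (- \<mu> * s))"
        proof (rule mult_left_mono)
          have "\<bar>Z d (s + T) - Z e (s + T)\<bar> \<le> 2 * dist d e * exp (- \<mu> * s)"
            "\<bar>Z d s - Z e s\<bar> \<le> 2 * dist d e * exp (- \<mu> * s)"
            by (rule Zlip; use s \<open>T > 0\<close> in simp)+
          then show "\<bar>(Z d (s + T) - Z e (s + T)) - (Z d s - Z e s)\<bar>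
              \<le> 2 * dist d e * exp (- \<mu> * s) + 2 * dist d e * exp (- \<mu> * s)" by linarith
        qed (use \<open>L > 0\<close> in simp)
        finally have "\<bar>h (Z d (s + T) - Z d s) - h (Z e (s + T) - Z e s)\<bar>
            \<le> 4 * L * dist d e * exp (- \<mu> * s)" by (simp add: algebra_simps)
        then show "\<exists>D. ((\<lambda>m. J d m - J e m) has_real_derivative D) (at s)
            \<and> \<bar>D\<bar> \<le> 4 * L * dist d e * exp (- \<mu> * s)"
          using DERIV_diff[OF J J] by blast
      qed (use J0 \<open>L > 0\<close> in auto)
      then have "exp (\<mu> * m) * \<bar>J d m - J e m\<bar> \<le> dist d e / 2"
        using \<open>L > 0\<close> by (simp add: \<mu>_def exp_minus field_simps)
      then show "dist (apply_bcontfun (\<Phi> d) t) (apply_bcontfun (\<Phi> e) t) \<le> 1 / 2 * dist d e"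
        by (simp add: \<Phi> dist_real_def m_def[symmetric] abs_mult right_diff_distrib[symmetric])
    qed
  qed auto
  then obtain d where d: "\<Phi> d = d" by blast
  have dt: "apply_bcontfun d t = exp (\<mu> * t) * J d t" if "t \<le> 0" for t
    using \<Phi>[of d t] that by (simp add: d)
  have ZJ: "Z d t = J d t" if "t \<le> 0" for t
    using that u(2) dt[of t] dt[of 0] J0 by (simp add: Z_def exp_minus)
  show ?thesis
  proof (rule that[of "Z d"])
    show "Z d t = u t" if "0 \<le> t" for t using that by (simp add: Z_def)
    show "(Z d has_real_derivative h (Z d (t + T) - Z d t)) (at t)" if "t < 0" for t
      by (rule has_field_derivative_transform_within_open[OF J, of "{..<0}"]) (use that ZJ in auto)
    have "(J d has_real_derivative h (Z d T - Z d 0)) (at 0 within {..0})"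
      using DERIV_subset[OF J[of d 0]] by simp
    then have "(Z d has_real_derivative h (Z d T - Z d 0)) (at 0 within {..0})"
      by (rule has_field_derivative_transform_within[of _ _ _ _ 1]) (use ZJ in auto)
    then show "(Z d has_real_derivative h (Z d T - Z d 0)) (at_left 0)"
      by (rule DERIV_subset) auto
  qed (rule cZ)
qed

section \<open>The slow road: speed as a function of the headway\<close>

locale two_speed_road =
  fixes l Vm Vp K q r1p rm r2m rp :: real and \<phi> :: "real \<Rightarrow> real"
  assumes l: "0 < l" and Vm: "0 < Vm" and Vp: "Vm < Vp" and K: "0 < K" and q: "0 < q"
    and \<phi>_decr: "\<And>x y. 0 \<le> x \<Longrightarrow> x < y \<Longrightarrow> y \<le> 1 \<Longrightarrow> \<phi> y < \<phi> x"
    and \<phi>_ends: "\<phi> 0 = 1" "\<phi> 1 = 0"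
    and \<phi>_lip: "\<And>x y. x \<in> {0..1} \<Longrightarrow> y \<in> {0..1} \<Longrightarrow> \<bar>\<phi> x - \<phi> y\<bar> \<le> K * \<bar>x - y\<bar>"
    and order: "0 < r1p" "r1p < rm" "rm < r2m" "r2m < 1" "r1p < rp" "rp < 1"
    and flux_eq: "Vp * r1p * \<phi> r1p = q" "Vp * rp * \<phi> rp = q" "Vm * rm * \<phi> rm = q" "Vm * r2m * \<phi> r2m = q"
    and flux_lt: "\<And>r. 0 < r \<Longrightarrow> r < rm \<Longrightarrow> Vm * r * \<phi> r < q"
    and flux_gt: "\<And>r. rm < r \<Longrightarrow> r < r2m \<Longrightarrow> q < Vm * r * \<phi> r"
begin

definition T where "T = l / q"

text \<open>The speed at \<open>x < 0\<close> as a function of the headway. The maximum only serves to make it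
  globally defined and Lipschitz.\<close>
definition h where "h g = Vm * \<phi> (l / max l g)"

lemma T_pos: "0 < T" using l q by (simp add: T_def)

lemma Vp_pos: "0 < Vp" using Vm Vp by simp

lemma \<phi>_antimono: "0 \<le> x \<Longrightarrow> x \<le> y \<Longrightarrow> y \<le> 1 \<Longrightarrow> \<phi> y \<le> \<phi> x"
  using \<phi>_decr[of x y] by (cases "x = y") auto

lemma \<phi>_pos: "0 \<le> x \<Longrightarrow> x < 1 \<Longrightarrow> 0 < \<phi> x"
  using \<phi>_decr[of x 1] \<phi>_ends by simp

lemma \<phi>_le_1: "0 \<le> x \<Longrightarrow> x \<le> 1 \<Longrightarrow> \<phi> x \<le> 1"
  using \<phi>_antimono[of 0 x] \<phi>_ends by simp

lemma continuous_\<phi>: "continuous_on {0..1} \<phi>"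
proof (rule lipschitz_on_continuous_on)
  show "K-lipschitz_on {0..1} \<phi>" using \<phi>_lip K by (intro lipschitz_onI) (auto simp: dist_real_def)
qed

lemma ratio_range: "l / max l g \<in> {0<..1}"
  using l by (auto simp: field_simps max_def)

lemma h_lip: "\<bar>h a - h b\<bar> \<le> Vm * K / l * \<bar>a - b\<bar>"
proof -
  define A B where "A = max l a" and "B = max l b"
  have AB: "l \<le> A" "l \<le> B" "\<bar>A - B\<bar> \<le> \<bar>a - b\<bar>" by (auto simp: A_def B_def)
  have "\<bar>l / A - l / B\<bar> = l * \<bar>A - B\<bar> / (A * B)"
  proof -
    have "l / A - l / B = l * (B - A) / (A * B)" using AB l by (simp add: field_simps)
    then show ?thesis using AB l by (simp add: abs_mult abs_divide abs_minus_commute)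
  qed
  also have "\<dots> \<le> l * \<bar>a - b\<bar> / (l * l)"
    using AB l by (intro frac_le mult_left_mono mult_mono) auto
  finally have *: "\<bar>l / A - l / B\<bar> \<le> \<bar>a - b\<bar> / l" using l by simp
  have "\<bar>h a - h b\<bar> = Vm * \<bar>\<phi> (l / A) - \<phi> (l / B)\<bar>"
    using Vm by (simp add: h_def A_def B_def abs_mult flip: right_diff_distrib)
  also have "\<dots> \<le> Vm * (K * \<bar>l / A - l / B\<bar>)"
    using \<phi>_lip[of "l / A" "l / B"] ratio_range[of a] ratio_range[of b] Vm
    by (intro mult_left_mono) (auto simp: A_def B_def)
  also have "\<dots> \<le> Vm * (K * (\<bar>a - b\<bar> / l))"
    using Vm K * by (intro mult_left_mono) auto
  finally show ?thesis by simp
qed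

lemma h_range: "0 \<le> h g" "h g \<le> Vm"
proof -
  have "0 \<le> \<phi> (l / max l g)" "\<phi> (l / max l g) \<le> 1"
    using \<phi>_antimono[of "l / max l g" 1] \<phi>_le_1[of "l / max l g"] \<phi>_ends ratio_range[of g] by auto
  then show "0 \<le> h g" "h g \<le> Vm" using Vm by (auto simp: h_def mult_left_le)
qed

lemma h_mono: "a \<le> b \<Longrightarrow> h a \<le> h b"
proof -
  assume "a \<le> b"
  then have "l / max l b \<le> l / max l a" using l by (intro frac_le) auto
  then show ?thesis unfolding h_def using ratio_range[of a] ratio_range[of b] Vm
    by (intro mult_left_mono \<phi>_antimono) auto
qed

lemma h_strict_mono: "l \<le> a \<Longrightarrow> a < b \<Longrightarrow> h a < h b"
proof -
  assume "l \<le> a" "a < b"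
  moreover from this have "l / b < l / a" using l by (intro divide_strict_left_mono) auto
  ultimately show ?thesis unfolding h_def using l Vm
    by (intro mult_strict_left_mono \<phi>_decr) (auto simp: max_def field_simps)
qed

lemma h_ratio: "l \<le> g \<Longrightarrow> h g = Vm * \<phi> (l / g)"
  by (simp add: h_def max_absorb2)

lemma continuous_h: "isCont h x"
proof -
  have "continuous_on UNIV h"
  proof (rule lipschitz_on_continuous_on)
    show "(Vm * K / l)-lipschitz_on UNIV h"
      using h_lip Vm K l by (intro lipschitz_onI) (auto simp: dist_real_def)
  qed
  then show ?thesis by (simp add: continuous_on_eq_continuous_at)
qed

text \<open>With \<open>r = l / b\<close> the inequality \<open>b < T * h b\<close> reads
  \<open>q < Vm * r * \<phi> r\<close>. Comparing the headway map with the identity is thus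
  comparing the slow flux with the level \<open>q\<close>, in reversed order.\<close>

lemma headway_fixed_points:
  "h (l / r2m) = q / r2m" "l / r2m < b \<Longrightarrow> b < l / rm \<Longrightarrow> b < T * h b"
  "l / rm < b \<Longrightarrow> T * h b < b"
proof -
  have "l < l / r2m" using l order by (simp add: field_simps)
  then show "h (l / r2m) = q / r2m" using h_ratio[of "l / r2m"] l order flux_eq by (simp add: field_simps)
  have lrm: "l < l / rm" using l order by (simp add: field_simps)
  show "b < T * h b" if b: "l / r2m < b" "b < l / rm"
  proof -
    have b0: "l < b" using \<open>l < l / r2m\<close> b by simp
    then have "rm < l / b" "l / b < r2m" using b order l by (auto simp: field_simps)
    from flux_gt[OF this] have "q * b < Vm * l * \<phi> (l / b)" using b0 l by (simp add: field_simps)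
    then show ?thesis using h_ratio[of b] b0 q by (simp add: T_def field_simps)
  qed
  show "T * h b < b" if b: "l / rm < b"
  proof -
    have b0: "l < b" using lrm b by simp
    then have "0 < l / b" "l / b < rm" using b order l by (auto simp: field_simps)
    from flux_lt[OF this] have "Vm * l * \<phi> (l / b) < q * b" using b0 l by (simp add: field_simps)
    then show ?thesis using h_ratio[of b] b0 q by (simp add: T_def field_simps)
  qed
qed

end

section \<open>The wave data and their travel time\<close>

locale wave_data = two_speed_road +
  fixes w :: "real \<Rightarrow> real"
  assumes w: "profile l \<phi> r1p rp w" and w_mono: "mono w" and w0: "w 0 \<le> r2m"
begin

text \<open>The speed on a road that is fast everywhere. The profile is stationary for that road on
  the whole line, so its travel time can be treated for every \<open>x\<close>.\<close>

definition v where "v x = Vp * \<phi> (w x)"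

lemma w_range: "r1p \<le> w x" "w x \<le> rp"
proof -
  have lim: "(w \<longlongrightarrow> r1p) at_bot" "(w \<longlongrightarrow> rp) at_top" using w by (auto simp: profile_def)
  have "\<forall>\<^sub>F y in at_bot. w y \<le> w x"
    using eventually_le_at_bot[of x] by (rule eventually_mono) (rule monoD[OF w_mono])
  then show "r1p \<le> w x" by (rule tendsto_upperbound[OF lim(1)]) auto
  have "\<forall>\<^sub>F y in at_top. w x \<le> w y"
    using eventually_ge_at_top[of x] by (rule eventually_mono) (rule monoD[OF w_mono])
  then show "w x \<le> rp" by (rule tendsto_lowerbound[OF lim(2)]) auto
qed

lemma w_01: "0 < w x" "w x < 1" using w_range[of x] order by auto

lemma w_deriv:
  "(w has_real_derivative (w x)\<^sup>2 / (l * \<phi> (w x)) * (\<phi> (w x) - \<phi> (w (x + l / w x)))) (at x)"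
  using w by (simp add: profile_def lead_def)

lemma continuous_w: "continuous_on S w"
  by (intro continuous_at_imp_continuous_on ballI DERIV_isCont[OF w_deriv])

lemma continuous_v: "continuous_on S v"
  unfolding v_def using w_01
  by (intro continuous_intros continuous_on_compose2[OF continuous_\<phi> continuous_w])
     (auto simp: less_imp_le)

lemma v_antimono: "x \<le> y \<Longrightarrow> v y \<le> v x"
  unfolding v_def using w_01[of x] w_01[of y] monoD[OF w_mono, of x y] Vp_pos
  by (intro mult_left_mono \<phi>_antimono) auto

lemma v_bounds: "q / rp \<le> v x" "v x \<le> q / r1p" "0 < v x" "v x \<le> Vp"
proof -
  have "Vp * \<phi> rp \<le> v x" "v x \<le> Vp * \<phi> r1p"
    using w_range[of x] order Vp_pos w_01[of x] by (auto simp: v_def intro!: \<phi>_antimono)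
  moreover have "Vp * \<phi> rp = q / rp" "Vp * \<phi> r1p = q / r1p" using flux_eq order by (auto simp: field_simps)
  ultimately show *: "q / rp \<le> v x" "v x \<le> q / r1p" by simp_all
  moreover have "0 < q / rp" using q order by simp
  ultimately show "0 < v x" by linarith
  show "v x \<le> Vp" using \<phi>_le_1[of "w x"] w_01[of x] Vp_pos by (simp add: v_def mult_left_le)
qed

text \<open>The leader position has derivative \<open>v y / v x\<close> with
  \<open>y = x + l / w x\<close>, so the difference is constant. By the mean value theorem it lies
  between the headway divided by the speed at \<open>x\<close> and the headway divided by the least
  speed \<open>q / rp\<close>; both tend to \<open>l / q\<close> at infinity.\<close>

lemma travel_time:
  assumes \<tau>: "\<And>x. (\<tau> has_real_derivative 1 / v x) (at x)"
  shows "\<tau> (x + l / w x) - \<tau> x = T"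
proof -
  define F where "F x = \<tau> (x + l / w x) - \<tau> x" for x
  have "(F has_real_derivative 0) (at x)" for x
  proof -
    define y where "y = x + l / w x"
    have p: "0 < w x" "0 < \<phi> (w x)" "0 < \<phi> (w y)" using w_01 by (auto intro!: \<phi>_pos less_imp_le)
    have g: "((\<lambda>x. x + l / w x) has_real_derivative \<phi> (w y) / \<phi> (w x)) (at x)"
      using p l by (auto intro!: derivative_eq_intros w_deriv simp: y_def[symmetric] power2_eq_square field_simps)
    have "(F has_real_derivative 1 / v y * (\<phi> (w y) / \<phi> (w x)) - 1 / v x) (at x)"
      unfolding F_def using DERIV_chain2[OF \<tau>[of y, unfolded y_def] g]
      by (intro DERIV_diff \<tau>) (simp add: y_def)
    moreover have "1 / v y * (\<phi> (w y) / \<phi> (w x)) - 1 / v x = 0" using p by (simp add: v_def)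
    ultimately show ?thesis by simp
  qed
  then have const: "F x = F y" for x y by (metis DERIV_isconst_all)
  have bound: "l / w x * (1 / v x) \<le> F x" "F x \<le> l / w x * (1 / (q / rp))" for x
  proof -
    have "0 < l / w x" using l w_01 by simp
    then obtain \<xi> where \<xi>: "x < \<xi>" "F x = l / w x * (1 / v \<xi>)"
      using MVT2[of x "x + l / w x" \<tau> "\<lambda>x. 1 / v x"] \<tau> by (auto simp: F_def)
    have "1 / v x \<le> 1 / v \<xi>" "1 / v \<xi> \<le> 1 / (q / rp)"
      using v_antimono[of x \<xi>] \<xi>(1) v_bounds[of x] v_bounds[of \<xi>] q order
      by (intro frac_le; simp)+
    then show "l / w x * (1 / v x) \<le> F x" "F x \<le> l / w x * (1 / (q / rp))"
      unfolding \<xi>(2) using \<open>0 < l / w x\<close> by (intro mult_left_mono; linarith)+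
  qed
  have lim: "(w \<longlongrightarrow> rp) at_top" using w by (simp add: profile_def)
  have "((\<lambda>x. \<phi> (w x)) \<longlongrightarrow> \<phi> rp) at_top"
    by (rule continuous_on_tendsto_compose[OF continuous_\<phi> lim])
       (use order w_01 in \<open>auto simp: less_imp_le\<close>)
  moreover have "rp \<noteq> 0" "Vp * \<phi> rp \<noteq> 0" using order flux_eq(2) q by auto
  ultimately have "((\<lambda>x. l / w x * (1 / v x)) \<longlongrightarrow> l / rp * (1 / (Vp * \<phi> rp))) at_top"
    unfolding v_def by (intro tendsto_intros lim)
  moreover have "((\<lambda>x. l / w x * (1 / (q / rp))) \<longlongrightarrow> l / rp * (1 / (q / rp))) at_top"
    using order by (intro tendsto_intros lim) auto
  moreover have "l / rp * (1 / (Vp * \<phi> rp)) = T" "l / rp * (1 / (q / rp)) = T"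
    using flux_eq(2) order by (auto simp: T_def field_simps)
  ultimately have lims: "((\<lambda>x. l / w x * (1 / v x)) \<longlongrightarrow> T) at_top"
    "((\<lambda>x. l / w x * (1 / (q / rp))) \<longlongrightarrow> T) at_top" by (simp_all only:)
  have "T \<le> F x"
  proof (rule tendsto_upperbound[OF lims(1)], intro always_eventually allI)
    show "l / w y * (1 / v y) \<le> F x" for y using bound(1)[of y] const[of y x] by simp
  qed simp
  moreover have "F x \<le> T"
  proof (rule tendsto_lowerbound[OF lims(2)], intro always_eventually allI)
    show "F x \<le> l / w y * (1 / (q / rp))" for y using bound(2)[of y] const[of y x] by simp
  qed simp
  ultimately show ?thesis by (simp add: F_def)
qed

end

section \<open>Bounds for the headway along the path\<close>

locale trajectory = wave_data +
  fixes \<tau> u z :: "real \<Rightarrow> real"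
  assumes \<tau>_0: "\<tau> 0 = 0" and \<tau>: "\<And>x. (\<tau> has_real_derivative 1 / v x) (at x)"
    and u_\<tau>: "\<And>x. u (\<tau> x) = x" and \<tau>_u: "\<And>t. \<tau> (u t) = t"
    and u: "\<And>t. (u has_real_derivative v (u t)) (at t)"
    and \<tau>_mono: "strict_mono \<tau>" and u_mono: "strict_mono u"
    and continuous_z: "continuous_on UNIV z" and z_u: "\<And>t. 0 \<le> t \<Longrightarrow> z t = u t"
    and z_deriv: "\<And>t. t < 0 \<Longrightarrow> (z has_real_derivative h (z (t + T) - z t)) (at t)"
    and z_left_deriv: "(z has_real_derivative h (z T - z 0)) (at_left 0)"
begin

definition G where "G t = z (t + T) - z t"

lemma u_0: "u 0 = 0" using u_\<tau>[of 0] \<tau>_0 by simp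

lemma z_0: "z 0 = 0" by (simp add: z_u u_0)

lemma continuous_u: "continuous_on S u"
  by (intro continuous_at_imp_continuous_on ballI DERIV_isCont[OF u])

lemma u_shift: "u (t + T) = u t + l / w (u t)"
proof -
  have "\<tau> (u t + l / w (u t)) = t + T" using travel_time[OF \<tau>, of "u t"] \<tau>_u[of t] by simp
  then show ?thesis using u_\<tau> by metis
qed

lemma G_nonneg_time: "0 \<le> t \<Longrightarrow> G t = l / w (u t)"
  using T_pos by (simp add: G_def z_u u_shift)

lemma continuous_G: "continuous_on S G"
  unfolding G_def
  by (intro continuous_intros continuous_on_compose2[OF continuous_z]) auto

lemma z_G: "t < 0 \<Longrightarrow> (z has_real_derivative h (G t)) (at t)"
  using z_deriv by (simp add: G_def)

lemma z_v: "0 < t \<Longrightarrow> (z has_real_derivative v (z t)) (at t)"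
  by (rule has_field_derivative_transform_within_open[of u _ t "{0<..}"]) (use u z_u in auto)

lemma z_growth_ge:
  assumes "a \<le> b" and neg: "\<And>t. a < t \<Longrightarrow> t \<le> b \<Longrightarrow> t < 0 \<Longrightarrow> c \<le> h (G t)"
    and pos: "\<And>t. a < t \<Longrightarrow> t \<le> b \<Longrightarrow> 0 < t \<Longrightarrow> c \<le> v (z t)"
  shows "c * (b - a) \<le> z b - z a"
proof (rule left_deriv_ge_imp_growth[OF \<open>a \<le> b\<close>, of _ "{0}"])
  fix t assume t: "a < t" "t \<le> b" "t \<notin> {0}"
  show "\<exists>D\<ge>c. (z has_real_derivative D) (at_left t)"
  proof (cases "t < 0")
    case True
    then show ?thesis using DERIV_subset[OF z_G[OF True], of "{..<t}"] neg[of t] t by auto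
  next
    case False
    then show ?thesis using DERIV_subset[OF z_v, of t "{..<t}"] pos[of t] t by auto
  qed
qed (use continuous_on_subset[OF continuous_z] in auto)

lemma z_growth_le:
  assumes "a \<le> b" and neg: "\<And>t. a < t \<Longrightarrow> t \<le> b \<Longrightarrow> t < 0 \<Longrightarrow> h (G t) \<le> c"
    and pos: "\<And>t. a < t \<Longrightarrow> t \<le> b \<Longrightarrow> 0 < t \<Longrightarrow> v (z t) \<le> c"
  shows "z b - z a \<le> c * (b - a)"
proof -
  have "- c * (b - a) \<le> - z b - - z a"
  proof (rule left_deriv_ge_imp_growth[OF \<open>a \<le> b\<close>, of _ "{0}"])
    fix t assume t: "a < t" "t \<le> b" "t \<notin> {0}"
    show "\<exists>D\<ge>- c. ((\<lambda>x. - z x) has_real_derivative D) (at_left t)"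
    proof (cases "t < 0")
      case True
      then show ?thesis
        using DERIV_minus[OF DERIV_subset[OF z_G[OF True], of "{..<t}"]] neg[of t] t
        by (intro exI[of _ "- h (G t)"]) auto
    next
      case False
      then show ?thesis
        using DERIV_minus[OF DERIV_subset[OF z_v, of t "{..<t}"]] pos[of t] t
        by (intro exI[of _ "- v (z t)"]) auto
    qed
  qed (use continuous_on_subset[OF continuous_z] in \<open>auto intro: continuous_intros\<close>)
  then show ?thesis by simp
qed

text \<open>At a maximum point \<open>s\<close> of the headway on \<open>{t..0}\<close>, the speed
  during \<open>{s..s + T}\<close> is at most \<open>max (h (G s)) (q / r1p)\<close>, the second
  entry covering the data. Hence \<open>G s \<le> max (T * h (G s)) (l / r1p)\<close>, which fails
  beyond \<open>l / r1p > l / rm\<close>, where \<open>T * h\<close> lies below the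
  identity.\<close>

lemma G_le: "G t \<le> l / r1p"
proof (rule ccontr)
  assume "\<not> G t \<le> l / r1p"
  then have gt: "l / r1p < G t" by simp
  have nonneg: "G s \<le> l / r1p" if "0 \<le> s" for s
    using that l order w_range[of "u s"] by (auto simp: G_nonneg_time intro!: frac_le)
  then have "t < 0" using gt by (meson not_le)
  then obtain s where s: "t \<le> s" "s \<le> 0" and max: "\<And>r. t \<le> r \<Longrightarrow> r \<le> 0 \<Longrightarrow> G r \<le> G s"
    using continuous_attains_sup[OF _ _ continuous_G, of "{t..0}"] by auto
  have big: "l / r1p < G s" using gt max[of t] \<open>t < 0\<close> by linarith
  define c where "c = max (h (G s)) (q / r1p)"
  have "z (s + T) - z s \<le> c * (s + T - s)"
  proof (rule z_growth_le)
    fix r assume "s < r" "r < 0"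
    then have "h (G r) \<le> h (G s)" using s max[of r] by (intro h_mono) auto
    then show "h (G r) \<le> c" by (simp add: c_def)
  qed (use T_pos v_bounds in \<open>auto simp: c_def intro: le_max_iff_disj[THEN iffD2]\<close>)
  then have "G s \<le> max (T * h (G s)) (T * (q / r1p))"
    using T_pos by (simp add: G_def c_def max_mult_distrib_left mult.commute)
  moreover have "T * (q / r1p) = l / r1p" using q by (simp add: T_def)
  ultimately have "G s \<le> T * h (G s)" using big by auto
  moreover have "l / rm < l / r1p" using l order by (auto intro!: divide_strict_left_mono)
  ultimately show False using headway_fixed_points(3)[of "G s"] big by simp
qed

text \<open>The data are concave in time and the mean of their speed over \<open>[0, T]\<close> is
  \<open>l / (T * w 0)\<close>, which is at least \<open>q / r2m\<close>.\<close>

lemma u_chord: "u T = l / w 0" "0 \<le> s \<Longrightarrow> s \<le> T \<Longrightarrow> q / r2m * s \<le> u s"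
proof -
  show uT: "u T = l / w 0" using u_shift[of 0] by (simp add: u_0)
  define c where "c = q / r2m"
  have "l / r2m \<le> l / w 0" using w0 w_01[of 0] l by (intro frac_le) auto
  moreover have "c * T = l / r2m" using q by (simp add: c_def T_def)
  ultimately have cT: "c * T \<le> u T" using uT by simp
  show "q / r2m * s \<le> u s" if s: "0 \<le> s" "s \<le> T"
  proof (rule ccontr)
    assume "\<not> q / r2m * s \<le> u s"
    then have lt: "u s < c * s" by (simp add: c_def)
    then have "0 < s" "s < T" using s u_0 cT by (auto simp: less_le)
    obtain a where a: "a < s" "u s - u 0 = (s - 0) * v (u a)"
      using MVT2[OF \<open>0 < s\<close>, of u "\<lambda>t. v (u t)"] u by blast
    obtain b where b: "s < b" "u T - u s = (T - s) * v (u b)"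
      using MVT2[OF \<open>s < T\<close>, of u "\<lambda>t. v (u t)"] u by blast
    have "s * v (u a) < s * c" using a lt u_0 by (simp add: mult.commute)
    then have "v (u a) < c" using \<open>0 < s\<close> by simp
    moreover have "(T - s) * c < (T - s) * v (u b)" using b lt cT by (simp add: algebra_simps)
    then have "c < v (u b)" using \<open>s < T\<close> by simp
    moreover have "v (u b) \<le> v (u a)"
      using a b by (intro v_antimono) (simp add: strict_mono_less_eq[OF u_mono])
    ultimately show False by simp
  qed
qed

text \<open>Here the data path meets the line of slope \<open>q / r2m\<close> at both
  \<open>0\<close> and \<open>T\<close>. It starts strictly faster, since \<open>Vm < Vp\<close> at
  the same density, and so gets ahead of the line; if its speed at \<open>T\<close> were still at
  least the slope, monotonicity of the speed would keep it ahead.\<close>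

lemma v_u_T_less: assumes "w 0 = r2m" shows "v (u T) < q / r2m"
proof (rule ccontr)
  define c where "c = q / r2m"
  assume "\<not> v (u T) < q / r2m"
  then have c: "c \<le> v (u T)" by (simp add: c_def)
  have "c = Vm * \<phi> r2m" using flux_eq order by (simp add: c_def field_simps)
  then have "c < v (u 0)" using Vp \<phi>_pos[of r2m] order assms by (simp add: v_def u_0)
  then have "((\<lambda>t. u t - c * t) has_real_derivative v (u 0) - c) (at 0)" "0 < v (u 0) - c"
    by (auto intro!: derivative_eq_intros u)
  then obtain d where d: "d > 0" "\<And>k. 0 < k \<Longrightarrow> k < d \<Longrightarrow> u 0 - c * 0 < u (0 + k) - c * (0 + k)"
    using DERIV_pos_inc_right[of "\<lambda>t. u t - c * t" "v (u 0) - c" 0] by auto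
  define k where "k = min (d / 2) (T / 2)"
  have k: "0 < k" "k < d" "k < T" using d T_pos by (auto simp: k_def)
  have "c * k < u k" using d(2)[of k] k by (simp add: u_0)
  moreover have "c * (T - k) \<le> z T - z k"
  proof (rule z_growth_ge)
    fix t assume "k < t" "t \<le> T"
    then have "v (u T) \<le> v (u t)" by (intro v_antimono) (simp add: strict_mono_less_eq[OF u_mono])
    then show "c \<le> v (z t)" using c k \<open>k < t\<close> z_u[of t] by simp
  qed (use k in auto)
  moreover have "c * T = l / r2m" using q by (simp add: c_def T_def)
  then have "c * T = u T" using u_chord(1) assms by simp
  ultimately show False using k T_pos by (simp add: z_u algebra_simps)
qed

text \<open>If \<open>w 0 = r2m\<close>, then \<open>G 0\<close> is on the barrier and continuity is
  not enough. The left derivative of \<open>G\<close> at \<open>0\<close> is the speed of the data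
  at time \<open>T\<close> minus \<open>h (G 0) = q / r2m\<close>; it is negative, so the headway
  grows backward in time.\<close>

lemma G_gt_near_0: "\<exists>\<delta>>0. \<forall>t. - \<delta> < t \<and> t < 0 \<longrightarrow> l / r2m < G t"
proof (cases "w 0 = r2m")
  case False
  then have "l / r2m < G 0"
    using w0 w_01[of 0] l by (simp add: G_nonneg_time u_0) (intro divide_strict_left_mono; simp)
  moreover have "isCont G 0" using continuous_G[of UNIV] by (simp add: continuous_on_eq_continuous_at)
  ultimately have "\<forall>\<^sub>F t in at_left 0. l / r2m < G t"
    by (auto simp: isCont_def filterlim_at_split order_tendstoD)
  then obtain b where "b < 0" "\<And>t. b < t \<Longrightarrow> t < 0 \<Longrightarrow> l / r2m < G t" by (auto simp: eventually_at_left_field)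
  then show ?thesis by (intro exI[of _ "- b"]) auto
next
  case True
  have G0: "G 0 = l / r2m" using True by (simp add: G_nonneg_time u_0)
  have "((\<lambda>t. z (t + T)) has_real_derivative v (z (0 + T)) * 1) (at_left 0)"
    by (rule DERIV_chain2[where f = z and g = "\<lambda>t. t + T"])
       (use T_pos z_v[of T] in \<open>auto intro!: derivative_eq_intros\<close>)
  from DERIV_diff[OF this z_left_deriv]
  have "(G has_real_derivative v (u T) - h (G 0)) (at_left 0)"
    using T_pos by (simp add: G_def[abs_def] z_u)
  moreover have "v (u T) - h (G 0) < 0" using v_u_T_less[OF True] headway_fixed_points(1) G0 by simp
  ultimately obtain d where d: "d > 0" "\<And>k. 0 < k \<Longrightarrow> k < d \<Longrightarrow> G 0 < G (0 - k)"
    using has_real_derivative_neg_dec_left[of G _ 0 "{..<0}"] by force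
  show ?thesis
  proof (intro exI[of _ d] conjI allI impI)
    show "l / r2m < G t" if "- d < t \<and> t < 0" for t using d(2)[of "- t"] that G0 by simp
  qed (rule d(1))
qed

text \<open>A last time \<open>a < 0\<close> with headway at most the barrier exists because a
  neighbourhood of \<open>0\<close> is free of such times. Between \<open>a\<close> and
  \<open>0\<close> the speed exceeds \<open>q / r2m\<close>, so the distance covered in
  \<open>{a..a + T}\<close> exceeds \<open>l / r2m\<close>, which contradicts the choice of
  \<open>a\<close>.\<close>

lemma G_gt: assumes "t < 0" shows "l / r2m < G t"
proof (rule ccontr)
  assume "\<not> l / r2m < G t"
  then have low: "G t \<le> l / r2m" by simp
  define c where "c = q / r2m"
  obtain \<delta> where \<delta>: "\<delta> > 0" "\<And>t. - \<delta> < t \<Longrightarrow> t < 0 \<Longrightarrow> l / r2m < G t" using G_gt_near_0 by blast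
  define S where "S = {s\<in>{..-\<delta>}. G s \<le> l / r2m}"
  have "t \<in> S" using \<delta>(2)[of t] low assms by (force simp: S_def)
  moreover have bdd: "bdd_above S" by (auto simp: S_def intro!: bdd_aboveI[of _ "-\<delta>"])
  moreover have "closed S" unfolding S_def
    by (rule continuous_on_closed_Collect_le) (auto intro: continuous_G)
  ultimately have Sup: "Sup S \<in> S" by (intro closed_contains_Sup) auto
  define a where "a = Sup S"
  have a: "a < 0" "G a \<le> l / r2m" using Sup \<delta>(1) by (auto simp: a_def S_def)
  have above: "l / r2m < G s" if "a < s" "s < 0" for s
    using that cSup_upper[OF _ bdd, of s] \<delta>(2)[of s] by (force simp: S_def a_def)
  have lr: "l < l / r2m" using l order by (simp add: field_simps)
  have fast: "c * (b - a) < z b - z a" if b: "a < b" "b \<le> 0" for b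
  proof -
    obtain D s where s: "a < s" "s < b" "(z has_real_derivative D) (at s)" "z b - z a = (b - a) * D"
      using MVT[OF b(1), of z] continuous_on_subset[OF continuous_z, of "{a..b}"] z_G b
      by (metis less_le_trans real_differentiable_def subset_UNIV)
    have "D = h (G s)" using DERIV_unique[OF s(3) z_G] s b by simp
    moreover have "c < h (G s)"
      using h_strict_mono[of "l / r2m" "G s"] above[of s] s b lr headway_fixed_points(1) by (simp add: c_def)
    ultimately show ?thesis using s b by (simp add: mult.commute)
  qed
  have cT: "c * T = l / r2m" using q by (simp add: c_def T_def)
  \<comment> \<open>If the window \<open>{a..a + T}\<close> reaches into the data, the part after
    \<open>0\<close> is controlled by \<open>u_chord\<close>, and the part before \<open>0\<close>
    supplies the strictness.\<close>
  have "c * T < G a"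
  proof (cases "a + T \<le> 0")
    case True
    then show ?thesis using fast[of "a + T"] T_pos by (simp add: G_def)
  next
    case False
    then have "c * (a + T) \<le> z (a + T)" using u_chord(2)[of "a + T"] a by (simp add: z_u c_def)
    then show ?thesis using fast[of 0] a by (simp add: G_def z_0 algebra_simps)
  qed
  then show False using a cT by simp
qed

lemma G_gt_l: "l < G t"
proof (cases "t < 0")
  case True
  have "l < l / r2m" using l order by (simp add: field_simps)
  then show ?thesis using G_gt[OF True] by simp
next
  case False
  then show ?thesis using w_01[of "u t"] l by (simp add: G_nonneg_time field_simps)
qed

lemma z_expanding: "x \<le> y \<Longrightarrow> min (q / r2m) (q / rp) * (y - x) \<le> z y - z x"
proof (rule z_growth_ge)
  fix t :: real assume "t < 0"
  then have "h (l / r2m) \<le> h (G t)" using G_gt[of t] by (intro h_mono) auto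
  then show "min (q / r2m) (q / rp) \<le> h (G t)" using headway_fixed_points(1) by simp
qed (use v_bounds in \<open>auto intro: min.coboundedI2\<close>)

section \<open>Convergence of the headway as time decreases\<close>

text \<open>The iteration needs a start strictly above its fixed point \<open>l / r2m\<close>. The
  gap is claimed only up to \<open>- T\<close>, since at \<open>0\<close> the headway may equal the
  barrier. Compactness gives it on one window of length \<open>T\<close>; a smaller minimum further
  back would violate \<open>b < T * h b\<close>.\<close>

lemma G_lower_bound:
  obtains a where "l / r2m < a" "\<And>t. t \<le> - T \<Longrightarrow> a \<le> G t"
proof -
  obtain s where s: "s \<in> {-2*T..-T}" and min: "\<And>r. r \<in> {-2*T..-T} \<Longrightarrow> G s \<le> G r"
    using continuous_attains_inf[OF _ _ continuous_G, of "{-2*T..-T}"] T_pos by auto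
  \<comment> \<open>The cap \<open>l / rm\<close> places every headway below \<open>a\<close> in the
    range where \<open>T * h\<close> lies above the identity.\<close>
  define a where "a = min (G s) (l / rm)"
  have "l / r2m < l / rm" using l order by (auto intro!: divide_strict_left_mono)
  then have a: "l / r2m < a" using G_gt[of s] s T_pos by (simp add: a_def)
  moreover have "a \<le> G t" if "t \<le> - T" for t
  proof (rule ccontr)
    assume "\<not> a \<le> G t"
    then have low: "G t < a" by simp
    have "{t..-T} \<noteq> {}" using that by simp
    then obtain b where "b \<in> {t..-T}" "\<forall>r\<in>{t..-T}. G b \<le> G r"
      using continuous_attains_inf[OF compact_Icc _ continuous_G] by blast
    then have b: "t \<le> b" "b \<le> - T" and minb: "\<And>r. t \<le> r \<Longrightarrow> r \<le> - T \<Longrightarrow> G b \<le> G r" by auto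
    have "G b < a" using minb[of t] that low by linarith
    \<comment> \<open>This puts the whole window \<open>{b..b + T}\<close> inside the range on which
      \<open>G b\<close> is minimal.\<close>
    have "b < - 2 * T" using min[of b] b \<open>G b < a\<close> by (force simp: a_def)
    have "h (G b) * (b + T - b) \<le> z (b + T) - z b"
      using b \<open>b < - 2 * T\<close> T_pos by (intro z_growth_ge) (auto intro!: h_mono minb)
    then have "T * h (G b) \<le> G b" by (simp add: G_def mult.commute)
    then show False
      using headway_fixed_points(2)[of "G b"] G_gt[of b] b T_pos \<open>G b < a\<close> by (simp add: a_def)
  qed
  ultimately show ?thesis using that by blast
qed

lemma eventually_G_step:
  assumes "\<forall>\<^sub>F t in at_bot. G t \<in> {a..b}"
  shows "\<forall>\<^sub>F t in at_bot. G t \<in> {T * h a..T * h b}"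
proof -
  obtain X where X: "\<And>t. t \<le> X \<Longrightarrow> a \<le> G t \<and> G t \<le> b"
    using assms by (auto simp: eventually_at_bot_linorder)
  have "G t \<in> {T * h a..T * h b}" if "t \<le> min X 0 - T" for t
  proof -
    have "h a * (t + T - t) \<le> z (t + T) - z t"
      using that T_pos by (intro z_growth_ge) (auto intro!: h_mono X[THEN conjunct1])
    moreover have "z (t + T) - z t \<le> h b * (t + T - t)"
      using that T_pos by (intro z_growth_le) (auto intro!: h_mono X[THEN conjunct2])
    ultimately show ?thesis by (simp add: G_def mult.commute)
  qed
  then show ?thesis by (auto simp: eventually_at_bot_linorder)
qed

lemma G_limit: "(G \<longlongrightarrow> l / rm) at_bot"
proof -
  have cN: "isCont (\<lambda>b. T * h b) x" for x by (intro continuous_intros continuous_h)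
  obtain a where a: "l / r2m < a" "\<And>t. t \<le> - T \<Longrightarrow> a \<le> G t" using G_lower_bound by blast
  have ev_a: "\<forall>\<^sub>F t in at_bot. a \<le> G t" using a(2) by (auto simp: eventually_at_bot_linorder)
  have lower: "\<forall>\<^sub>F t in at_bot. p \<le> G t" if "p < l / rm" for p
  proof (rule eventually_ge_by_iteration[OF ev_a _ cN _ _ that, where B = "l / r1p"])
    show "b < T * h b" if "a \<le> b" "b < l / rm" for b using headway_fixed_points(2) that a by simp
    show "\<forall>\<^sub>F t in at_bot. T * h b \<le> G t" if "\<forall>\<^sub>F t in at_bot. b \<le> G t" for b
    proof -
      have "\<forall>\<^sub>F t in at_bot. G t \<in> {b..l / r1p}" using that by (rule eventually_mono) (simp add: G_le)
      from eventually_G_step[OF this] show ?thesis by (rule eventually_mono) simp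
    qed
  qed (use G_le in auto)
  \<comment> \<open>The upper bound is a lower bound for \<open>- G\<close> under the map conjugated
    by the sign change, started from the global bound \<open>l / r1p\<close> of
    \<open>G_le\<close>.\<close>
  have upper: "\<forall>\<^sub>F t in at_bot. - p \<le> - G t" if "l / rm < p" for p
  proof (rule eventually_ge_by_iteration[where N = "\<lambda>b. - (T * h (- b))" and p = "- (l / rm)"])
    show "\<forall>\<^sub>F t in at_bot. - (l / r1p) \<le> - G t" by (simp add: G_le)
    show "\<forall>\<^sub>F t in at_bot. - G t \<le> - a" using ev_a by simp
    show "isCont (\<lambda>b. - (T * h (- b))) b" for b
      by (intro continuous_intros isCont_o2[OF _ continuous_h, where f = uminus])
    show "b < - (T * h (- b))" if "b < - (l / rm)" for b using headway_fixed_points(3)[of "- b"] that by simp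
    show "\<forall>\<^sub>F t in at_bot. - (T * h (- b)) \<le> - G t" if "\<forall>\<^sub>F t in at_bot. b \<le> - G t" for b
    proof -
      have "\<forall>\<^sub>F t in at_bot. G t \<in> {a..- b}" using that ev_a by eventually_elim simp
      from eventually_G_step[OF this] show ?thesis by (rule eventually_mono) simp
    qed
  qed (use that in simp)
  show ?thesis
  proof (rule order_tendstoI)
    fix p assume "p < l / rm"
    then obtain p' where p': "p < p'" "p' < l / rm" using dense by blast
    show "\<forall>\<^sub>F t in at_bot. p < G t" using lower[OF p'(2)] by (rule eventually_mono) (use p' in simp)
  next
    fix p assume "l / rm < p"
    then obtain p' where p': "l / rm < p'" "p' < p" using dense by blast
    show "\<forall>\<^sub>F t in at_bot. G t < p" using upper[OF p'(1)] by (rule eventually_mono) (use p' in simp)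
  qed
qed

section \<open>Back to the density as a function of position\<close>

definition \<theta> where "\<theta> = inv z"

definition Q where "Q x = l / G (\<theta> x)"

lemma \<theta>: "\<theta> (z t) = t" "z (\<theta> x) = x" "isCont \<theta> x" "strict_mono \<theta>" "strict_mono z"
proof -
  obtain g where "\<And>t. g (z t) = t" "\<And>x. z (g x) = x" "\<And>x. isCont g x" "strict_mono z" "strict_mono g"
  proof (rule expanding_imp_inverse[OF continuous_z _ z_expanding])
    show "0 < min (q / r2m) (q / rp)" using q order by simp
  qed blast+
  then show "\<theta> (z t) = t" "z (\<theta> x) = x" "isCont \<theta> x" "strict_mono \<theta>" "strict_mono z"
    by (simp_all add: \<theta>_def inv_equality[of g z])
qed

lemma z_neg_iff: "z t < 0 \<longleftrightarrow> t < 0"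
  using strict_mono_less[OF \<theta>(5), of t 0] by (simp add: z_0)

lemma Q_z: "Q (z t) = l / G t"
  by (simp add: Q_def \<theta>)

lemma Q_nonneg: "0 \<le> x \<Longrightarrow> Q x = w x"
proof -
  assume "0 \<le> x"
  then have "0 \<le> \<theta> x" using z_neg_iff[of "\<theta> x"] \<theta>(2) by simp
  then show ?thesis using \<theta>(2)[of x] l z_u[of "\<theta> x"] by (simp add: Q_def G_nonneg_time)
qed

lemma piece_Q: "piece Q w = Q"
  by (auto simp: piece_def Q_nonneg)

lemma lead_Q: "lead l Q (z t) = z (t + T)"
  using l by (simp add: lead_def Q_z) (simp add: G_def)

lemma continuous_Q: "continuous_on S Q"
proof -
  have "G t \<noteq> 0" for t using G_gt_l[of t] l by simp
  then show ?thesis unfolding Q_def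
    using \<theta>(3) by (intro continuous_intros continuous_on_compose2[OF continuous_G[of UNIV]])
      (auto intro!: continuous_at_imp_continuous_on)
qed

lemma Q_01: "0 < Q x" "Q x < 1"
  using G_gt_l[of "\<theta> x"] l by (auto simp: Q_def)

lemma Q_at_bot: "(Q \<longlongrightarrow> rm) at_bot"
proof -
  have "filterlim \<theta> at_bot at_bot"
  proof (rule filterlim_at_bot[THEN iffD2], intro allI)
    fix b
    have "\<theta> x \<le> b" if "x \<le> z b" for x
      using strict_mono_less_eq[OF \<theta>(5), of "\<theta> x" b] \<theta>(2) that by simp
    then show "\<forall>\<^sub>F x in at_bot. \<theta> x \<le> b" by (auto simp: eventually_at_bot_linorder)
  qed
  then have "((\<lambda>x. G (\<theta> x)) \<longlongrightarrow> l / rm) at_bot" by (rule filterlim_compose[OF G_limit])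
  then have "((\<lambda>x. l / G (\<theta> x)) \<longlongrightarrow> l / (l / rm)) at_bot" using l order by (intro tendsto_intros) auto
  then show ?thesis using l by (simp add: Q_def[abs_def])
qed

lemma Q_at_top: "(Q \<longlongrightarrow> rp) at_top"
proof -
  have "\<forall>\<^sub>F x in at_top. w x = Q x" using eventually_ge_at_top[of 0] by (rule eventually_mono) (simp add: Q_nonneg)
  moreover have "(w \<longlongrightarrow> rp) at_top" using w by (simp add: profile_def)
  ultimately show ?thesis by (rule Lim_transform_eventually[rotated])
qed

lemma \<theta>_deriv: "x < 0 \<Longrightarrow> (\<theta> has_real_derivative 1 / h (G (\<theta> x))) (at x)"
proof -
  assume "x < 0"
  then have "\<theta> x < 0" using z_neg_iff[of "\<theta> x"] \<theta>(2) by simp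
  then have "h (l / r2m) < h (G (\<theta> x))" using G_gt l order by (intro h_strict_mono) (auto simp: field_simps)
  then have "h (G (\<theta> x)) \<noteq> 0" using h_range(1)[of "l / r2m"] by simp
  then show ?thesis
    using DERIV_inverse_function[of z "h (G (\<theta> x))" \<theta> x "x - 1" "x + 1"] \<theta> z_G[OF \<open>\<theta> x < 0\<close>]
    by (simp add: inverse_eq_divide)
qed

definition V where "V x = (if x < 0 then Vm else Vp)"

lemma V_pos: "0 < V x" using Vm Vp by (simp add: V_def)

lemma z_speed: "t \<noteq> 0 \<Longrightarrow> (z has_real_derivative V (z t) * \<phi> (Q (z t))) (at t)"
proof (cases "t < 0")
  case True
  then show ?thesis using z_G[OF True] h_ratio[of "G t"] G_gt_l[of t] by (simp add: V_def z_neg_iff Q_z)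
next
  case False
  assume "t \<noteq> 0"
  then show ?thesis using z_v[of t] False z_neg_iff[of t] by (simp add: V_def v_def Q_nonneg)
qed

text \<open>The headway changes at the rate \<open>d - c\<close>, the speed of the leader minus the
  own speed; division by the own speed \<open>c\<close> passes from time to position.\<close>

lemma Q_deriv:
  assumes "x < 0" "lead l Q x \<noteq> 0"
  shows "(Q has_real_derivative (Q x)\<^sup>2 / (l * V x * \<phi> (Q x)) *
    (V x * \<phi> (Q x) - V (lead l Q x) * \<phi> (Q (lead l Q x)))) (at x)"
proof -
  define t where "t = \<theta> x"
  have x: "x = z t" and t: "t < 0" using assms z_neg_iff[of "\<theta> x"] \<theta>(2) by (simp_all add: t_def)
  have tT: "t + T \<noteq> 0" using assms z_0 by (auto simp: x lead_Q)
  define c d where "c = V x * \<phi> (Q x)" and "d = V (lead l Q x) * \<phi> (Q (lead l Q x))"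
  have zc: "(z has_real_derivative c) (at t)" using z_speed[of t] t by (simp add: x c_def)
  have "(z has_real_derivative d) (at (t + T))" using z_speed[OF tT] by (simp add: x d_def lead_Q)
  then have "((\<lambda>t. z (t + T)) has_real_derivative d * 1) (at t)"
    by (intro DERIV_chain2[where f = z and g = "\<lambda>t. t + T"]) (auto intro!: derivative_eq_intros)
  from DERIV_diff[OF this zc] have G': "(G has_real_derivative d - c) (at t)" by (simp add: G_def[abs_def])
  have "c = h (G t)" using DERIV_unique[OF zc z_G[OF t]] .
  then have th: "(\<theta> has_real_derivative 1 / c) (at x)" using \<theta>_deriv[OF assms(1)] by (simp add: t_def)
  have "((\<lambda>x. G (\<theta> x)) has_real_derivative (d - c) * (1 / c)) (at x)"
    by (rule DERIV_chain2[OF _ th]) (use G' in \<open>simp add: t_def\<close>)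
  moreover have g0: "0 < G t" using G_gt_l[of t] l by simp
  moreover have "0 < c" using V_pos[of x] \<phi>_pos[of "Q x"] Q_01[of x] by (simp add: c_def)
  ultimately have "(Q has_real_derivative l * (c - d) / (c * (G t)\<^sup>2)) (at x)"
    unfolding Q_def[abs_def]
    by (auto intro!: derivative_eq_intros simp: t_def[symmetric] power2_eq_square field_simps)
  moreover have "l * (c - d) / (c * (G t)\<^sup>2) = (Q x)\<^sup>2 / (l * c) * (c - d)"
    using l g0 by (simp add: x Q_z power2_eq_square field_simps)
  ultimately show ?thesis by (simp add: c_def d_def mult.assoc)
qed

text \<open>When \<open>x\<close> and its leader lie on the same side of \<open>0\<close>, the
  common speed factor cancels, so both branches are instances of one formula in \<open>V\<close>.
  The leader being strictly ahead excludes all other configurations.\<close>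

lemma stat_eq_iff:
  assumes "0 < P x"
  shows "stat_eq l \<phi> Vm Vp P x \<longleftrightarrow>
    (x \<noteq> 0 \<and> lead l P x \<noteq> 0 \<longrightarrow> (P has_real_derivative (P x)\<^sup>2 / (l * V x * \<phi> (P x)) *
      (V x * \<phi> (P x) - V (lead l P x) * \<phi> (P (lead l P x)))) (at_left x))"
proof -
  have *: "(P x)\<^sup>2 / (l * k * \<phi> (P x)) * (k * \<phi> (P x) - k * \<phi> b) = (P x)\<^sup>2 / (l * \<phi> (P x)) * (\<phi> (P x) - \<phi> b)"
    if "0 < k" for k b
    using that by (simp flip: right_diff_distrib)
  have "x < lead l P x" using assms l by (simp add: lead_def)
  then show ?thesis
    using *[OF Vm] *[OF Vp_pos] by (auto simp: stat_eq_def V_def not_less le_less)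
qed

lemma solves_on_Q: "solves_on l \<phi> Vm Vp UNIV Q"
  unfolding solves_on_def
proof (intro conjI ballI)
  have "{x \<in> UNIV. lead l Q x = 0} \<subseteq> {z (- T)}"
  proof safe
    fix x assume "lead l Q x = 0"
    then have "z (\<theta> x + T) = z 0" using lead_Q[of "\<theta> x"] \<theta>(2) z_0 by simp
    then have "\<theta> x = - T" using strict_mono_eq[OF \<theta>(5)] by simp
    then show "x = z (- T)" using \<theta>(2)[of x] by simp
  qed
  then show "interior {x \<in> UNIV. lead l Q x = 0} = {}"
    using interior_mono[of "{x \<in> UNIV. lead l Q x = 0}" "{z (- T)}"] by (simp add: interior_singleton)
  fix x
  show "stat_eq l \<phi> Vm Vp Q x"
    unfolding stat_eq_iff[of Q x, OF Q_01(1)]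
  proof (intro impI, elim conjE)
    assume x: "x \<noteq> 0" "lead l Q x \<noteq> 0"
    show "(Q has_real_derivative (Q x)\<^sup>2 / (l * V x * \<phi> (Q x)) *
      (V x * \<phi> (Q x) - V (lead l Q x) * \<phi> (Q (lead l Q x)))) (at_left x)"
    proof (cases "x < 0")
      case True
      then show ?thesis using DERIV_subset[OF Q_deriv[OF True x(2)], of "{..<x}"] by simp
    next
      case False
      then have "0 < x" using x by simp
      have y: "0 < x + l / w x" using \<open>0 < x\<close> l w_01 by (simp add: add_pos_pos)
      have "(Q has_real_derivative (w x)\<^sup>2 / (l * \<phi> (w x)) * (\<phi> (w x) - \<phi> (w (x + l / w x)))) (at x)"
        by (rule has_field_derivative_transform_within_open[OF w_deriv, of "{0<..}"])
           (use \<open>0 < x\<close> Q_nonneg in auto)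
      from DERIV_subset[OF this, of "{..<x}"] show ?thesis
        using \<open>0 < x\<close> y Vp_pos by (simp add: Q_nonneg lead_def V_def flip: right_diff_distrib)
    qed
  qed
qed (use Q_01 in auto)

lemma stationary_wave_Q: "stationary_wave l \<phi> Vm Vp rm rp Q"
  using continuous_Q solves_on_Q Q_at_bot Q_at_top by (simp add: stationary_wave_def)

lemma ivp_solution_Q: "ivp_solution l \<phi> Vm Vp w Q"
proof -
  have "interior {x \<in> {..<0}. lead l Q x = 0} \<subseteq> interior {x \<in> UNIV. lead l Q x = 0}"
    by (rule interior_mono) auto
  then show ?thesis
    using continuous_Q solves_on_Q by (auto simp: ivp_solution_def piece_Q solves_on_def)
qed

section \<open>Uniqueness for the initial value problem\<close>

text \<open>An arbitrary solution offers only left derivatives, and its speed field may jump at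
  \<open>0\<close>. Its path is therefore built by separation of variables on each side of
  \<open>0\<close> and glued. The clause on the interior makes the set of exceptional points finite,
  so that the travel-time argument passes through them.\<close>

lemma ivp_solution_unique:
  assumes R: "ivp_solution l \<phi> Vm Vp w R" and "x < 0"
  shows "R x = Q x"
proof -
  define P where "P = piece R w"
  have cP: "continuous_on {..0} P" and P01: "\<And>x. x < 0 \<Longrightarrow> 0 < P x \<and> P x < 1"
    and int: "interior {x \<in> {..<0}. lead l P x = 0} = {}"
    and st: "\<And>x. x < 0 \<Longrightarrow> stat_eq l \<phi> Vm Vp P x"
    using R by (auto simp: ivp_solution_def solves_on_def P_def)
  have Pw: "P x = w x" if "0 \<le> x" for x using that by (simp add: P_def piece_def)
  have P: "0 < P x" "P x < 1" for x
    using P01[of x] w_01[of x] Pw[of x] by (cases "x < 0"; simp)+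
  define vP where "vP x = V x * \<phi> (P x)" for x
  have vP: "0 < vP x" for x using V_pos[of x] \<phi>_pos[of "P x"] P[of x] by (simp add: vP_def)
  define g where "g x = lead l P x" for x
  have g: "g x = x + l / P x" "x < g x" for x using P[of x] l by (auto simp: g_def lead_def)
  have cg: "continuous_on {..0} g"
    using P unfolding g(1) by (intro continuous_intros cP) (auto simp: less_imp_neq[symmetric])

  \<comment> \<open>This ratio of speeds is positive, which makes \<open>g\<close> monotone, and it
    is also what cancels in the travel time.\<close>
  have g_deriv: "(g has_real_derivative vP (g y) / vP y) (at_left y)" if "y < 0" "g y \<noteq> 0" for y
  proof -
    have D: "(P has_real_derivative (P y)\<^sup>2 / (l * vP y) * (vP y - vP (g y))) (at_left y)"
      using st[OF that(1)] that unfolding stat_eq_iff[of P y, OF P(1)]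
      by (simp add: vP_def g_def mult.assoc)
    show ?thesis
      unfolding g(1)[abs_def] using P(1)[of y] vP[of y] l
      by (auto intro!: derivative_eq_intros D simp: power2_eq_square field_simps g(1))
  qed

  text \<open>Only the level \<open>0\<close> of \<open>g\<close> is exceptional, hence \<open>g\<close> is increasing and that level
    set is an interval, which by assumption has no interior.\<close>
  have g_mono: "g a \<le> g b" if "a \<le> b" "b \<le> 0" for a b
  proof (rule left_deriv_pos_imp_le[OF that(1), of g "{y. y = 0 \<or> g y = 0}"])
    show "continuous_on {a..b} g" using that by (intro continuous_on_subset[OF cg]) auto
    show "finite (g ` {y. y = 0 \<or> g y = 0})" by (rule finite_subset[of _ "{0, g 0}"]) auto
    fix y assume "a < y" "y \<le> b" "y \<notin> {y. y = 0 \<or> g y = 0}"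
    then show "\<exists>D>0. (g has_real_derivative D) (at_left y)"
      using g_deriv[of y] that vP by (intro exI[of _ "vP (g y) / vP y"]) simp
  qed
  define E where "E = {y. y < 0 \<and> g y = 0}"
  have "a = b" if "a \<in> E" "b \<in> E" "a \<le> b" for a b
  proof (rule ccontr)
    assume "a \<noteq> b"
    have "{a<..<b} \<subseteq> {x \<in> {..<0}. lead l P x = 0}"
    proof
      fix y assume "y \<in> {a<..<b}"
      then show "y \<in> {x \<in> {..<0}. lead l P x = 0}"
        using g_mono[of a y] g_mono[of y b] that by (auto simp: E_def g_def)
    qed
    then have "{a<..<b} \<subseteq> interior {x \<in> {..<0}. lead l P x = 0}" by (rule interior_maximal) simp
    then show False using int that \<open>a \<noteq> b\<close> by simp
  qed
  then have "E \<subseteq> {a}" if "a \<in> E" for a using that by (metis linear singletonI subsetI)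
  then have finE: "finite E" by (metis finite.emptyI finite.insertI finite_subset ex_in_conv)

  \<comment> \<open>Freezing \<open>P\<close> at its value at \<open>0\<close> for
    \<open>x > 0\<close> avoids the change from \<open>Vm\<close> to \<open>Vp\<close>, so that
    \<open>flow_exists\<close> applies to a continuous field.\<close>
  define v1 where "v1 x = Vm * \<phi> (P (min x 0))" for x
  have cv1: "continuous_on UNIV v1"
    unfolding v1_def using P
    by (intro continuous_intros continuous_on_compose2[OF continuous_\<phi>] continuous_on_compose2[OF cP])
       (auto simp: less_imp_le)
  have v1: "0 < v1 x" "v1 x \<le> Vm" for x
    using \<phi>_pos[of "P (min x 0)"] \<phi>_le_1[of "P (min x 0)"] P[of "min x 0"] Vm
    by (auto simp: v1_def mult_left_le)
  obtain \<tau>1 z1 where \<tau>1: "\<tau>1 0 = 0" "\<And>x. (\<tau>1 has_real_derivative 1 / v1 x) (at x)"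
    and z1: "\<And>x. z1 (\<tau>1 x) = x" "\<And>t. \<tau>1 (z1 t) = t" "\<And>t. (z1 has_real_derivative v1 (z1 t)) (at t)"
    and mono1: "strict_mono \<tau>1" "strict_mono z1"
    using flow_exists[OF cv1 v1] by blast
  have z10: "z1 0 = 0" using z1(1)[of 0] \<tau>1 by simp
  \<comment> \<open>All four functions vanish at \<open>0\<close>, so the sums with
    \<open>min\<close> and \<open>max\<close> are the glued functions and are continuous without a
    case distinction.\<close>
  define \<tau>P zP where "\<tau>P x = \<tau>1 (min x 0) + \<tau> (max x 0)" and "zP t = z1 (min t 0) + u (max t 0)" for x t
  have \<tau>P_neg: "\<tau>P x = \<tau>1 x" and zP_neg: "zP x = z1 x" if "x \<le> 0" for x
    using that \<tau>_0 u_0 by (simp_all add: \<tau>P_def zP_def)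
  have \<tau>P_pos: "\<tau>P x = \<tau> x" and zP_pos: "zP x = u x" if "0 \<le> x" for x
    using that \<tau>1(1) z10 by (simp_all add: \<tau>P_def zP_def)
  have zP_\<tau>P: "zP (\<tau>P y) = y" for y
  proof (cases "y \<le> 0")
    case True
    then have "\<tau>1 y \<le> 0" using strict_mono_less_eq[OF mono1(1), of y 0] \<tau>1(1) by simp
    then show ?thesis using True by (simp add: \<tau>P_neg zP_neg z1)
  next
    case False
    then have "0 \<le> \<tau> y" using strict_mono_less_eq[OF \<tau>_mono, of 0 y] \<tau>_0 by simp
    then show ?thesis using False by (simp add: \<tau>P_pos zP_pos u_\<tau>)
  qed
  have ct1: "continuous_on S \<tau>1" "continuous_on S z1" "continuous_on S \<tau>" for S
    by (intro continuous_at_imp_continuous_on ballI DERIV_isCont[OF \<tau>1(2)] DERIV_isCont[OF z1(3)] DERIV_isCont[OF \<tau>])+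
  have c\<tau>P: "continuous_on UNIV \<tau>P" and czP: "continuous_on UNIV zP"
    unfolding \<tau>P_def zP_def
    by (intro continuous_intros continuous_on_compose2[OF ct1(1)[of UNIV]]
        continuous_on_compose2[OF ct1(2)[of UNIV]] continuous_on_compose2[OF ct1(3)[of UNIV]]
        continuous_on_compose2[OF continuous_u[of UNIV]]; simp)+
  have \<tau>P_deriv: "(\<tau>P has_real_derivative 1 / vP y) (at y)" if "y \<noteq> 0" for y
  proof (cases "y < 0")
    case True
    have "1 / v1 y = 1 / vP y" using True by (simp add: v1_def vP_def V_def)
    then show ?thesis
      using has_field_derivative_transform_within_open[OF \<tau>1(2)[of y], of "{..<0}" \<tau>P] True \<tau>P_neg by simp
  next
    case False
    have "1 / v y = 1 / vP y" using False by (simp add: v_def vP_def V_def Pw)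
    then show ?thesis
      using has_field_derivative_transform_within_open[OF \<tau>[of y], of "{0<..}" \<tau>P] that False \<tau>P_pos by simp
  qed

  \<comment> \<open>The leader of \<open>0\<close> lies in the region of the data, so the constant
    is fixed by \<open>travel_time\<close> at \<open>0\<close>.\<close>
  have shift: "\<tau>P (g y) = \<tau>P y + T" if "y \<le> 0" for y
  proof -
    define F where "F y = \<tau>P (g y) - \<tau>P y" for y
    have "F y = F 0"
    proof (rule left_deriv_zero_imp_eq[OF that, of F "insert 0 E"])
      show "continuous_on {y..0} F"
        unfolding F_def
        by (intro continuous_intros continuous_on_compose2[OF c\<tau>P] continuous_on_subset[OF cg]
            continuous_on_subset[OF c\<tau>P]) auto
      show "finite (insert 0 E)" using finE by simp
      fix r assume "y < r" "r \<le> 0" "r \<notin> insert 0 E"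
      then have r: "r < 0" "g r \<noteq> 0" by (auto simp: E_def)
      have "(F has_real_derivative 1 / vP (g r) * (vP (g r) / vP r) - 1 / vP r) (at_left r)"
        unfolding F_def using r \<tau>P_deriv[of r]
        by (intro DERIV_diff DERIV_chain2[OF \<tau>P_deriv g_deriv])
           (auto intro: has_field_derivative_at_within)
      then show "(F has_real_derivative 0) (at_left r)" using vP[of "g r"] by simp
    qed
    moreover have "g 0 = l / w 0" by (simp add: g(1) Pw)
    then have "F 0 = T" using travel_time[OF \<tau>, of 0] g(2)[of 0] by (simp add: F_def \<tau>P_pos)
    ultimately show ?thesis by (simp add: F_def)
  qed
  have gap: "zP (t + T) - zP t = l / P (z1 t)" if "t \<le> 0" for t
  proof -
    have y: "z1 t \<le> 0" using strict_mono_less_eq[OF mono1(2), of t 0] z10 that by simp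
    then have "g (z1 t) = zP (t + T)"
      using zP_\<tau>P[of "g (z1 t)"] by (simp add: shift \<tau>P_neg z1)
    then show ?thesis using that by (simp add: g(1) zP_neg)
  qed
  have zP_z: "zP t = z t" for t
  proof (rule advanced_equation_unique[OF T_pos _ h_lip _ czP _ continuous_z z_deriv])
    show "0 < Vm * K / l" using Vm K l by simp
    show "\<bar>h a\<bar> \<le> Vm" for a using h_range[of a] by simp
    show "zP t = z t" if "0 \<le> t" for t using that by (simp add: zP_pos z_u)
    fix t :: real assume t: "t < 0"
    have "z1 t < 0" using strict_mono_less[OF mono1(2), of t 0] z10 t by simp
    then have "v1 (z1 t) = Vm * \<phi> (P (z1 t))" by (simp add: v1_def)
    \<comment> \<open>The headway \<open>l / P (z1 t)\<close> exceeds \<open>l\<close>, so the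
      maximum in \<open>h\<close> is inactive.\<close>
    also have "\<dots> = h (zP (t + T) - zP t)"
      using P[of "z1 t"] l t by (subst gap; simp) (subst h_ratio; simp add: field_simps)
    finally show "(zP has_real_derivative h (zP (t + T) - zP t)) (at t)"
      using has_field_derivative_transform_within_open[OF z1(3)[of t], of "{..<0}" zP] t zP_neg by simp
  qed
  define t where "t = \<tau>1 x"
  have t: "t < 0" "z1 t = x"
    using strict_mono_less[OF mono1(1), of x 0] \<tau>1(1) \<open>x < 0\<close> z1 by (simp_all add: t_def)
  have "l / P x = G t" using gap[of t] t by (simp add: zP_z G_def)
  moreover have "z t = x" using zP_z[of t] zP_neg[of t] t by simp
  then have "Q x = l / G t" using Q_z[of t] by simp
  ultimately have "Q x = l / (l / P x)" by simp
  then have "P x = Q x" using l by simp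
  then show ?thesis using \<open>x < 0\<close> by (simp add: P_def piece_def)
qed

end

section \<open>Assembly, concave fluxes and shifted profiles\<close>

lemma (in wave_data) ivp_solvable:
  "\<exists>Q. ivp_solution l \<phi> Vm Vp w Q \<and>
     (\<forall>R. ivp_solution l \<phi> Vm Vp w R \<longrightarrow> (\<forall>x<0. R x = Q x)) \<and>
     (Q \<longlongrightarrow> rm) at_bot \<and> stationary_wave l \<phi> Vm Vp rm rp (piece Q w)"
proof -
  obtain \<tau> u where \<tau>u: "\<tau> 0 = 0" "\<And>x. (\<tau> has_real_derivative 1 / v x) (at x)"
    "\<And>x. u (\<tau> x) = x" "\<And>t. \<tau> (u t) = t" "\<And>t. (u has_real_derivative v (u t)) (at t)"
    "strict_mono \<tau>" "strict_mono u"
    using flow_exists[OF continuous_v v_bounds(3,4)] by blast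
  have "u 0 = 0" using \<tau>u(1) \<tau>u(3)[of 0] by simp
  moreover have "continuous_on UNIV u" by (intro continuous_at_imp_continuous_on ballI DERIV_isCont[OF \<tau>u(5)])
  moreover have "0 < Vm * K / l" using Vm K l by simp
  moreover have "\<bar>h a\<bar> \<le> Vm" for a using h_range[of a] by simp
  ultimately obtain z where z: "continuous_on UNIV z" "\<And>t. 0 \<le> t \<Longrightarrow> z t = u t"
    "\<And>t. t < 0 \<Longrightarrow> (z has_real_derivative h (z (t + T) - z t)) (at t)"
    "(z has_real_derivative h (z T - z 0)) (at_left 0)"
    using advanced_equation_exists[OF T_pos _ h_lip, of Vm u] by blast
  interpret trajectory l Vm Vp K q r1p rm r2m rp \<phi> w \<tau> u z
    by unfold_locales (fact \<tau>u z)+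
  show ?thesis
  proof (intro exI[of _ Q] conjI allI impI)
    show "stationary_wave l \<phi> Vm Vp rm rp (piece Q w)" by (simp only: piece_Q stationary_wave_Q)
  qed (rule ivp_solution_Q ivp_solution_unique Q_at_bot; assumption)+
qed

lemma has_derivs2_mvt:
  assumes "has_derivs2 f f1 f2" "0 \<le> x" "x < y" "y \<le> 1"
  obtains a b where "x < a" "a < y" "f y - f x = (y - x) * f1 a"
    and "x < b" "b < y" "f1 y - f1 x = (y - x) * f2 b"
proof -
  have D: "(f has_real_derivative f1 t) (at t within {x..y})" "(f1 has_real_derivative f2 t) (at t within {x..y})"
    if "t \<in> {x..y}" for t
    using assms that by (auto simp: has_derivs2_def intro: DERIV_subset[of _ _ _ "{0..1}"])
  have c: "continuous_on {x..y} f" "continuous_on {x..y} f1"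
    by (rule DERIV_continuous_on, erule D)+
  have at: "(f has_real_derivative f1 t) (at t)" "(f1 has_real_derivative f2 t) (at t)" if "x < t" "t < y" for t
    using D[of t] that by (auto simp: at_within_Icc_at)
  obtain D1 a where a: "x < a" "a < y" "(f has_real_derivative D1) (at a)" "f y - f x = (y - x) * D1"
    using MVT[OF assms(3) c(1)] at(1) by (auto simp: real_differentiable_def)
  obtain D2 b where b: "x < b" "b < y" "(f1 has_real_derivative D2) (at b)" "f1 y - f1 x = (y - x) * D2"
    using MVT[OF assms(3) c(2)] at(2) by (auto simp: real_differentiable_def)
  show ?thesis
    using that[of a b] a b DERIV_unique[OF a(3) at(1)] DERIV_unique[OF b(3) at(2)] by simp
qed

lemma concave_unimodal:
  assumes f: "has_derivs2 f f1 f2" and c: "0 < c" "\<forall>x\<in>{0..1}. f2 x \<le> - c"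
    and r: "0 < r" "r < 1" "f1 r = 0"
  shows "0 \<le> x \<Longrightarrow> x < y \<Longrightarrow> y \<le> r \<Longrightarrow> f x < f y" "r \<le> x \<Longrightarrow> x < y \<Longrightarrow> y \<le> 1 \<Longrightarrow> f y < f x"
proof -
  have dec: "f1 b < f1 a" if ab: "0 \<le> a" "a < b" "b \<le> 1" for a b
  proof -
    obtain t where "a < t" "t < b" "f1 b - f1 a = (b - a) * f2 t" using has_derivs2_mvt[OF f ab] by metis
    moreover from this have "f2 t < 0" using c(1) bspec[OF c(2), of t] ab by simp
    ultimately show ?thesis using ab mult_pos_neg[of "b - a" "f2 t"] by simp
  qed
  show "f x < f y" if xy: "0 \<le> x" "x < y" "y \<le> r"
  proof -
    obtain t where t: "x < t" "t < y" "f y - f x = (y - x) * f1 t"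
    proof (rule has_derivs2_mvt[OF f, of x y])
      show "y \<le> 1" "0 \<le> x" using xy r by simp_all
    qed (use xy in blast)+
    have "0 < f1 t" using dec[of t r] t xy r by simp
    then have "0 < (y - x) * f1 t" using xy by simp
    then show ?thesis using t by simp
  qed
  show "f y < f x" if xy: "r \<le> x" "x < y" "y \<le> 1"
  proof -
    obtain t where t: "x < t" "t < y" "f y - f x = (y - x) * f1 t"
    proof (rule has_derivs2_mvt[OF f, of x y])
      show "y \<le> 1" "0 \<le> x" using xy r by simp_all
    qed (use xy in blast)+
    have "f1 t < 0" using dec[of r t] t xy r by simp
    then have "(y - x) * f1 t < 0" using xy by (simp add: mult_pos_neg)
    then show ?thesis using t by simp
  qed
qed

lemma profile_shift:
  assumes "profile l \<phi> a b W"
  shows "profile l \<phi> a b (shift s W)"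
proof -
  have W: "(W has_real_derivative
      (W x)\<^sup>2 / (l * \<phi> (W x)) * (\<phi> (W x) - \<phi> (W (lead l W x)))) (at x)"
    and lim: "(W \<longlongrightarrow> a) at_bot" "(W \<longlongrightarrow> b) at_top" and W01: "0 < W x" "W x < 1" for x
    using assms by (auto simp: profile_def)
  have "(shift s W has_real_derivative (shift s W x)\<^sup>2 / (l * \<phi> (shift s W x)) *
      (\<phi> (shift s W x) - \<phi> (shift s W (lead l (shift s W) x)))) (at x)" for x
  proof -
    have "lead l (shift s W) x + s = lead l W (x + s)" by (simp add: lead_def shift_def)
    then show ?thesis unfolding shift_def using W[of "x + s"] by (simp only: DERIV_shift)
  qed
  moreover have "((\<lambda>x. W (x + s)) \<longlongrightarrow> a) at_bot"
  proof (rule filterlim_compose[OF lim(1)], rule filterlim_at_bot[THEN iffD2], intro allI)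
    show "\<forall>\<^sub>F x in at_bot. x + s \<le> Z" for Z
      using eventually_le_at_bot[of "Z - s"] by (rule eventually_mono) simp
  qed
  moreover have "((\<lambda>x. W (x + s)) \<longlongrightarrow> b) at_top"
  proof (rule filterlim_compose[OF lim(2)], rule filterlim_at_top[THEN iffD2], intro allI)
    show "\<forall>\<^sub>F x in at_top. Z \<le> x + s" for Z
      using eventually_ge_at_top[of "Z - s"] by (rule eventually_mono) simp
  qed
  ultimately show ?thesis
    using W01 by (simp only: profile_def) (simp add: shift_def)
qed

theorem theorem4p1:
  fixes l c0 chat Vm Vp rs rm rp r1p r2m :: real
    and \<phi> \<phi>1 \<phi>2 fm1 fm2 fp1 fp2 W :: "real \<Rightarrow> real"
  assumes l: "0 < l"
    and V: "0 < Vm" "Vm < Vp"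
    and phi_range: "\<forall>x\<in>{0..1}. \<phi> x \<in> {0..1}"
    and phi_ends: "\<phi> 0 = 1" "\<phi> 1 = 0"
    and phi_derivs: "has_derivs2 \<phi> \<phi>1 \<phi>2"
    and phi_decr: "0 < chat" "\<forall>x\<in>{0..1}. \<phi>1 x \<le> - chat"
    and flux_derivs: "has_derivs2 (flux Vm \<phi>) fm1 fm2" "has_derivs2 (flux Vp \<phi>) fp1 fp2"
    and flux_concave: "0 < c0" "\<forall>x\<in>{0..1}. fm2 x \<le> - c0" "\<forall>x\<in>{0..1}. fp2 x \<le> - c0"
    and rs: "0 < rs" "rs < 1" "fm1 rs = 0" "fp1 rs = 0"
    and rp: "rs < rp" "rp < 1"
    and rm: "0 < rm" "rm < rs" "flux Vm \<phi> rm = flux Vp \<phi> rp"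
    and r1p: "0 \<le> r1p" "r1p < rs" "flux Vp \<phi> r1p = flux Vp \<phi> rp"
    and r2m: "rs < r2m" "r2m \<le> 1" "flux Vm \<phi> r2m = flux Vp \<phi> rp"
    and W: "profile l \<phi> r1p rp W" "mono W"
  shows
    "(\<forall>s. r1p \<le> shift s W 0 \<and> shift s W 0 \<le> r2m \<longrightarrow>
        (\<exists>Q. ivp_solution l \<phi> Vm Vp (shift s W) Q \<and>
             (\<forall>R. ivp_solution l \<phi> Vm Vp (shift s W) R \<longrightarrow> (\<forall>x<0. R x = Q x)) \<and>
             (Q \<longlongrightarrow> rm) at_bot \<and>
             stationary_wave l \<phi> Vm Vp rm rp (piece Q (shift s W))))
     \<and> infinite ((\<lambda>Q. Q 0) `
          {Q. stationary_wave l \<phi> Vm Vp rm rp Q \<and> r1p \<le> Q 0 \<and> Q 0 \<le> r2m \<and>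
              (\<exists>s. \<forall>x\<ge>0. Q x = shift s W x)})"
proof -
  define q where "q = flux Vp \<phi> rp"
  have Vp0: "0 < Vp" using V by simp
  have \<phi>_decr: "\<phi> y < \<phi> x" if xy: "0 \<le> x" "x < y" "y \<le> 1" for x y
  proof -
    obtain t where "x < t" "t < y" "\<phi> y - \<phi> x = (y - x) * \<phi>1 t"
      using has_derivs2_mvt[OF phi_derivs xy] by metis
    moreover from this have "\<phi>1 t < 0" using phi_decr(1) bspec[OF phi_decr(2), of t] xy by simp
    ultimately show ?thesis using xy mult_pos_neg[of "y - x" "\<phi>1 t"] by simp
  qed
  \<comment> \<open>The second derivative makes \<open>\<phi>1\<close> continuous; a bound for it on
    the compact interval is the Lipschitz constant \<open>K\<close>.\<close>
  have "continuous_on {0..1} \<phi>1"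
    using phi_derivs unfolding has_derivs2_def by (intro DERIV_continuous_on) blast
  then have "bounded (\<phi>1 ` {0..1})" by (intro compact_imp_bounded compact_continuous_image) auto
  then obtain K where K: "0 < K" "\<And>t. 0 \<le> t \<Longrightarrow> t \<le> 1 \<Longrightarrow> \<bar>\<phi>1 t\<bar> \<le> K"
    unfolding bounded_pos by auto
  have \<phi>_lip: "\<bar>\<phi> x - \<phi> y\<bar> \<le> K * \<bar>x - y\<bar>" if xy: "x \<in> {0..1}" "y \<in> {0..1}" for x y
    using xy
  proof (induction x y rule: linorder_less_wlog)
    case (less x y)
    obtain t where "x < t" "t < y" "\<phi> y - \<phi> x = (y - x) * \<phi>1 t"
    proof (rule has_derivs2_mvt[OF phi_derivs, of x y])
      show "0 \<le> x" "y \<le> 1" using less by simp_all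
    qed (use less in blast)+
    moreover from this have "\<bar>\<phi>1 t\<bar> \<le> K" using less by (intro K) auto
    ultimately have "\<bar>\<phi> y - \<phi> x\<bar> \<le> K * \<bar>y - x\<bar>"
      by (simp add: abs_mult mult.commute mult_right_mono)
    then show ?case by (simp add: abs_minus_commute)
  qed (auto simp: abs_minus_commute)
  have \<phi>_pos: "0 < \<phi> x" if "0 \<le> x" "x < 1" for x using \<phi>_decr[of x 1] that phi_ends by simp
  note Vm_uni = concave_unimodal[OF flux_derivs(1) flux_concave(1,2) rs(1,2,3)]
  \<comment> \<open>Positivity of \<open>q\<close> excludes the end points \<open>r1p = 0\<close>
    and \<open>r2m = 1\<close>, where the fluxes vanish.\<close>
  have "0 < q" using Vp0 rp rs \<phi>_pos[of rp] by (simp add: q_def flux_def)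
  have "r1p \<noteq> 0" using \<open>0 < q\<close> r1p(3) by (auto simp: q_def flux_def)
  then have "0 < r1p" using r1p by simp
  \<comment> \<open>At equal density the slow flux is below the fast one. As it increases up to
    \<open>rs\<close>, it attains the level \<open>q\<close> only to the right of
    \<open>r1p\<close>.\<close>
  have "flux Vm \<phi> r1p < q"
  proof -
    have "Vm * (r1p * \<phi> r1p) < Vp * (r1p * \<phi> r1p)"
      using V \<open>0 < r1p\<close> \<phi>_pos[of r1p] r1p rs by (intro mult_strict_right_mono) auto
    then show ?thesis using r1p(3) Vp0 by (simp add: q_def flux_def mult.assoc)
  qed
  then have "r1p < rm" using Vm_uni(1)[of rm r1p] rm r1p unfolding q_def
    by (cases rm r1p rule: linorder_cases) auto
  have "r2m \<noteq> 1" using \<open>0 < q\<close> r2m(3) phi_ends by (auto simp: q_def flux_def)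
  then have "r2m < 1" using r2m by simp
  have data: "wave_data l Vm Vp K q r1p rm r2m rp \<phi> (shift s W)" if "shift s W 0 \<le> r2m" for s
  proof
    show "profile l \<phi> r1p rp (shift s W)" using W(1) by (rule profile_shift)
    show "mono (shift s W)" using W(2) by (auto simp: shift_def mono_def)
    show "Vm * r * \<phi> r < q" if "0 < r" "r < rm" for r
      using Vm_uni(1)[of r rm] that rm by (simp add: q_def flux_def)
    show "q < Vm * r * \<phi> r" if "rm < r" "r < r2m" for r
      using Vm_uni(1)[of rm r] Vm_uni(2)[of r r2m] that rm r2m
      by (cases "r \<le> rs") (simp_all add: q_def flux_def)
  qed (use l V K \<open>0 < q\<close> \<phi>_decr phi_ends \<phi>_lip \<open>0 < r1p\<close> \<open>r1p < rm\<close> \<open>r2m < 1\<close> rs rp rm r1p r2m that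
       in \<open>auto simp: q_def flux_def\<close>)
  note solvable = wave_data.ivp_solvable[OF data]
  \<comment> \<open>Every such value lies strictly between the limits of \<open>W\<close>, hence is
    attained, and shifting that point to \<open>0\<close> gives a wave with this value of
    \<open>Q 0\<close>. It is admissible because \<open>rs < r2m\<close>.\<close>
  have "{r1p<..<rs} \<subseteq> (\<lambda>Q. Q 0) `
      {Q. stationary_wave l \<phi> Vm Vp rm rp Q \<and> r1p \<le> Q 0 \<and> Q 0 \<le> r2m \<and>
          (\<exists>s. \<forall>x\<ge>0. Q x = shift s W x)}"
  proof
    fix y assume y: "y \<in> {r1p<..<rs}"
    have lim: "(W \<longlongrightarrow> r1p) at_bot" "(W \<longlongrightarrow> rp) at_top" using W by (auto simp: profile_def)
    obtain a where a: "W a < y"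
      using order_tendstoD(2)[OF lim(1), of y] y by (auto simp: eventually_at_bot_linorder)
    obtain b where b: "y < W b"
      using order_tendstoD(1)[OF lim(2), of y] y rp by (auto simp: eventually_at_top_linorder)
    have "a \<le> b" using a b W(2) by (meson less_imp_le less_trans monoD not_le)
    moreover have "continuous_on {a..b} W"
      using W(1) by (auto simp: profile_def intro!: continuous_at_imp_continuous_on DERIV_isCont)
    ultimately obtain s where "W s = y" using IVT'[of W a y b] a b by auto
    then have s: "shift s W 0 = y" by (simp add: shift_def)
    then obtain Q where Q: "stationary_wave l \<phi> Vm Vp rm rp (piece Q (shift s W))"
      using solvable[of s] y r2m by auto
    show "y \<in> (\<lambda>Q. Q 0) ` {Q. stationary_wave l \<phi> Vm Vp rm rp Q \<and> r1p \<le> Q 0 \<and> Q 0 \<le> r2m \<and>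
          (\<exists>s. \<forall>x\<ge>0. Q x = shift s W x)}"
    proof (rule image_eqI)
      show "y = piece Q (shift s W) 0" using s by (simp add: piece_def)
      then show "piece Q (shift s W) \<in> {Q. stationary_wave l \<phi> Vm Vp rm rp Q \<and> r1p \<le> Q 0 \<and> Q 0 \<le> r2m \<and>
          (\<exists>s. \<forall>x\<ge>0. Q x = shift s W x)}"
        using Q y r2m by (auto simp: piece_def)
    qed
  qed
  moreover have "infinite {r1p<..<rs}" using r1p by simp
  ultimately show ?thesis using solvable infinite_super by blast
qed

end
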